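(* Assume (A1)--(A6) (stated in the context). For $\delta=(\delta_0,\dots,\delta_{N-1})\in(0,\infty)^N$ and noisy data $y^\delta=(y_0^\delta,\dots,y_{N-1}^\delta)$ with $\|y_j-y_j^\delta\|_{L^1}\le\delta_j$, $j=0,\dots,N-1$, let $\{x_k^\delta\}$ be the loping OS-EM iteration and let the stopping index be $$k_*^\delta:=\min\{qN\in\mathbb N:\ x_{qN}^\delta=x_{qN+1}^\delta=\dots=x_{qN+N-1}^\delta\},$$ that is, $k_*^\delta$ is the smallest integer multiple of $N$ such that $x_{k_*^\delta}^\delta=x_{k_*^\delta+1}^\delta=\dots=x_{k_*^\delta+N-1}^\delta$. Then: (i) The stopping index $k_*^\delta$ is finite. (ii) More precisely, $k_*^\delta=O(\delta_{\min}^{-1})$, where $\delta_{\min}:=\min\{\delta_0,\dots,\delta_{N-1}\}$. (iii) $d(y_j^\delta,\mathcal A_jx_{k_*^\delta}^\delta)\le\tau\gamma\delta_j$ for every $j=0,\dots,N-1$. (iv) For every $p\in[1,+\infty)$ and every $j=0,\dots,N-1$, $\lim_{\delta\to0}\|\mathcal A_jx_{k_*^\delta}^\delta-y_j\|_{L^p(\Sigma)}=0$. (v) Let $\{\delta^l=(\delta_0^l,\dots,\delta_{N-1}^l)\}_{l\in\mathbb N}$ be a sequence in $(0,\infty)^N$ with $\lim_{l\to\infty}\delta_j^l=0$ for each $0\le j\le N-1$, and let $\{y^l=(y_0^l,\dots,y_{N-1}^l)\}_{l\in\mathbb N}$ be a sequence of noisy data satisfying $\|y_j-y_j^l\|_{L^1}\le\delta_j^l$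 for $j=0,\dots,N-1$, $l\in\mathbb N$ (and (A5), (A6)). Let $k_*^l:=k_*^{\delta^l}=k_*(\delta^l,y^l)$ denote the corresponding stopping index and $x_{k_*^l}^{\delta^l}$ the corresponding stopped iterate. If the sequence $\{x_{k_*^l}^{\delta^l}\}_{l\in\mathbb N}$ is bounded in $L^p(\Omega)$ for some $p\in(1,+\infty)$, then it has a subsequence which converges weakly in $L^p(\Omega)$ to a solution of the system $\mathcal A_jx=y_j$, $j=0,\dots,N-1$.
   Context: $\Omega$ and $\Sigma$ are open bounded subsets of $\mathbb R^d$, $d\ge1$, and $N\ge1$ is an integer; $\mathbb N$ includes $0$. For $j=0,\dots,N-1$, $a_j:\Sigma\times\Omega\to\mathbb R$ are kernel functions, $y_j\in L^1(\Sigma)$ are the exact data, and $(\mathcal A_jx)(s)=\int_\Omega a_j(s,t)x(t)\,dt$ defines $\mathcal A_j:L^1(\Omega)\to L^1(\Sigma)$. The Kullback--Leibler distance of $L^1$ functions $v,u$ (both on $\Omega$ or both on $\Sigma$) is $d(v,u)=\int\big[v(t)\ln\frac{v(t)}{u(t)}-v(t)+u(t)\big]\,dt$. $\Delta=\{x\in L^1(\Omega): x\ge0,\ \int_\Omega x(t)\,dt=1\}$, and $x_0\in\Delta$ is a fixed starting element. Assumptions: (A1) $\int_\Sigma a_j(s,t)\,ds=1$ for a.e. $t\in\Omega$, $j=0,\dots,N-1$. (A2) There are positive constants $m,M$ with $m\le a_j(s,t)\le M$ a.e. in $\Sigma\times\Omega$, for all $j$. (A3) $\int_\Sigma y_j(s)\,ds=1$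 for all $j$, and there is $M'>0$ with $y_j(s)\le M'$ a.e. in $\Sigma$ for all $j$. (A4) The system $\mathcal A_jx=y_j$, $j=0,\dots,N-1$, has a nonnegative solution $x^*\in L^1(\Omega)$ which does not vanish a.e. in $\Omega$, and $d(x^*,x_0)<\infty$. (A5) The noisy data $y_j^\delta\in L^1(\Sigma)$ satisfy $\int_\Sigma y_j^\delta(s)\,ds=1$. (A6) There exist $M_1,m_1>0$ such that $m_1\le y_j^\delta\le M_1$ a.e. in $\Sigma$, for all $j$. The constants $m_1,M_1$ are fixed, independent of $\delta$ and of the noisy data considered. Set $f_j^\delta(x)=d(y_j^\delta,\mathcal A_jx)$ and $[k]:=k\bmod N$. Fix constants $\tau>1$ and $\gamma=\max\{|\ln\frac{m_1}{M}|,|\ln\frac{M_1}{m}|\}$. The loping OS-EM iteration is $x_0^\delta=x_0$, $x_{k+1}^\delta=x_k^\delta\,\omega_k$, where $$\omega_k(t)=\int_\Sigma\frac{a_{[k]}(s,t)\,y_{[k]}^\delta(s)}{(\mathcal A_{[k]}x_k^\delta)(s)}\,ds\quad\text{if } f_{[k]}^\delta(x_k^\delta)>\tau\gamma\delta_{[k]},\qquad \omega_k=1\quad\text{otherwise.}$$ In (ii), $k_*^\delta=O(\delta_{\min}^{-1})$ means that there is a constant $C$, independent of $\delta$ and of the noisy data, with $k_*^\delta\le C/\delta_{\min}$. In (iv), the limit is over noise levels $\delta\to0$ with any corresponding noisy data satisfying $\|y_j-y_j^\delta\|_{L^1}\le\delta_j$, (A5) and (A6).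
   Formalization: The stopping index is taken as the least multiple qN with x_{qN}=…=x_{qN+N} (one more equality than stated), since the chain ending at x_{qN+N-1} never tests the last equation and makes (iii)–(v) false, e.g. for N=1, where it always gives index 0. *)

theory Defs
  imports "HOL-Analysis.Analysis"
begin

text \<open>Elements of \<open>L\<^sup>p(S)\<close> are represented by real functions on the whole space that are
  only inspected on \<open>S\<close>; equality and order in \<open>L\<^sup>p(S)\<close> are meant almost everywhere on \<open>S\<close>.\<close>

text \<open>\<open>L\<^sup>p\<close> for finite \<open>p\<close>. The norm is meaningful only together with membership,
  because the Bochner integral of a non-integrable function is \<open>0\<close>.\<close>

definition Lp_space :: "'a::euclidean_space set \<Rightarrow> real \<Rightarrow> ('a \<Rightarrow> real) set" where
  "Lp_space S p =
     {f \<in> borel_measurable (lebesgue_on S). integrable (lebesgue_on S) (\<lambda>t. \<bar>f t\<bar> powr p)}"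

definition Lp_norm :: "'a::euclidean_space set \<Rightarrow> real \<Rightarrow> ('a \<Rightarrow> real) \<Rightarrow> real" where
  "Lp_norm S p f = (LINT t|lebesgue_on S. \<bar>f t\<bar> powr p) powr (1 / p)"

text \<open>Weak convergence in \<open>L\<^sup>p(S)\<close>, \<open>1 < p < \<infinity>\<close>, with the dual space identified with
  \<open>L\<^sup>q(S)\<close>, \<open>1/p + 1/q = 1\<close>.\<close>

definition weakly_converges_Lp ::
    "'a::euclidean_space set \<Rightarrow> real \<Rightarrow> (nat \<Rightarrow> 'a \<Rightarrow> real) \<Rightarrow> ('a \<Rightarrow> real) \<Rightarrow> bool" where
  "weakly_converges_Lp S p f g \<longleftrightarrow>
     (\<forall>l. f l \<in> Lp_space S p) \<and> g \<in> Lp_space S p \<and>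
     (\<forall>h \<in> Lp_space S (p / (p - 1)).
        (\<lambda>l. LINT t|lebesgue_on S. f l t * h t) \<longlonglongrightarrow> (LINT t|lebesgue_on S. g t * h t))"

text \<open>The integrand of the Kullback--Leibler distance is nonnegative for \<open>v, u \<ge> 0\<close>, so the
  distance is a well-defined element of \<open>[0, \<infinity>]\<close>. Conventions: \<open>0 ln (0 / u) = 0\<close> and
  \<open>v ln (v / 0) = \<infinity>\<close> for \<open>v > 0\<close>. Negative arguments lie outside the domain of the
  distance; they get the value \<open>\<infinity>\<close>.\<close>

definition KL_integrand :: "real \<Rightarrow> real \<Rightarrow> ennreal" where
  "KL_integrand v u =
     (if v < 0 \<or> u < 0 \<or> (u = 0 \<and> v > 0) then \<infinity> else ennreal (v * ln (v / u) - v + u))"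

definition KL_dist :: "'a::euclidean_space set \<Rightarrow> ('a \<Rightarrow> real) \<Rightarrow> ('a \<Rightarrow> real) \<Rightarrow> ennreal" where
  "KL_dist S v u = (\<integral>\<^sup>+ t. KL_integrand (v t) (u t) \<partial>lebesgue_on S)"

definition prob_densities :: "'a::euclidean_space set \<Rightarrow> ('a \<Rightarrow> real) set" where
  "prob_densities \<Omega> =
     {x. integrable (lebesgue_on \<Omega>) x \<and> (AE t in lebesgue_on \<Omega>. 0 \<le> x t) \<and>
         (LINT t|lebesgue_on \<Omega>. x t) = 1}"

definition kernel_op ::
    "'a::euclidean_space set \<Rightarrow> ('a \<Rightarrow> 'a \<Rightarrow> real) \<Rightarrow> ('a \<Rightarrow> real) \<Rightarrow> 'a \<Rightarrow> real" where
  "kernel_op \<Omega> k x = (\<lambda>s. LINT t|lebesgue_on \<Omega>. k s t * x t)"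

definition solves_system ::
    "'a::euclidean_space set \<Rightarrow> 'a set \<Rightarrow> nat \<Rightarrow> (nat \<Rightarrow> 'a \<Rightarrow> 'a \<Rightarrow> real) \<Rightarrow> (nat \<Rightarrow> 'a \<Rightarrow> real) \<Rightarrow>
     ('a \<Rightarrow> real) \<Rightarrow> bool" where
  "solves_system \<Omega> \<Sigma> N a y x \<longleftrightarrow>
     integrable (lebesgue_on \<Omega>) x \<and>
     (\<forall>j<N. AE s in lebesgue_on \<Sigma>. kernel_op \<Omega> (a j) x s = y j s)"

definition noisy_data ::
    "'a::euclidean_space set \<Rightarrow> nat \<Rightarrow> real \<Rightarrow> real \<Rightarrow> (nat \<Rightarrow> 'a \<Rightarrow> real) \<Rightarrow>
     (nat \<Rightarrow> real) \<Rightarrow> (nat \<Rightarrow> 'a \<Rightarrow> real) \<Rightarrow> bool" where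
  "noisy_data \<Sigma> N m1 M1 y \<delta> yd \<longleftrightarrow>
     (\<forall>j<N. 0 < \<delta> j \<and> integrable (lebesgue_on \<Sigma>) (yd j) \<and>
        (LINT s|lebesgue_on \<Sigma>. \<bar>y j s - yd j s\<bar>) \<le> \<delta> j \<and>
        (LINT s|lebesgue_on \<Sigma>. yd j s) = 1 \<and>
        (AE s in lebesgue_on \<Sigma>. m1 \<le> yd j s \<and> yd j s \<le> M1))"

primrec loping_osem ::
    "'a::euclidean_space set \<Rightarrow> 'a set \<Rightarrow> nat \<Rightarrow> (nat \<Rightarrow> 'a \<Rightarrow> 'a \<Rightarrow> real) \<Rightarrow> real \<Rightarrow> real \<Rightarrow>
     ('a \<Rightarrow> real) \<Rightarrow> (nat \<Rightarrow> real) \<Rightarrow> (nat \<Rightarrow> 'a \<Rightarrow> real) \<Rightarrow> nat \<Rightarrow> 'a \<Rightarrow> real" where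
  "loping_osem \<Omega> \<Sigma> N a \<tau> \<gamma> x0 \<delta> yd 0 = x0"
| "loping_osem \<Omega> \<Sigma> N a \<tau> \<gamma> x0 \<delta> yd (Suc k) =
     (let x = loping_osem \<Omega> \<Sigma> N a \<tau> \<gamma> x0 \<delta> yd k;
          j = k mod N;
          Ax = kernel_op \<Omega> (a j) x;
          \<omega> = (if KL_dist \<Sigma> (yd j) Ax > ennreal (\<tau> * \<gamma> * \<delta> j)
               then (\<lambda>t. LINT s|lebesgue_on \<Sigma>. a j s t * yd j s / Ax s)
               else (\<lambda>t. 1))
      in (\<lambda>t. x t * \<omega> t))"

text \<open>The iteration stops at the first multiple \<open>qN\<close> such that none of the \<open>N\<close> updates
  \<open>qN, \<dots>, qN + N - 1\<close> of the cycle changes the iterate. These \<open>N\<close> updates involve the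
  \<open>N + 1\<close> iterates \<open>x\<^bsub>qN\<^esub>, \<dots>, x\<^bsub>qN+N\<^esub>\<close>, so the equalities have to include
  \<open>x\<^bsub>qN+N\<^esub>\<close>: a chain ending with \<open>x\<^bsub>qN+N-1\<^esub>\<close> never tests the last equation
  (for \<open>N = 1\<close> it is void and gives stopping index \<open>0\<close> for all data), and then the
  residual bound and the convergence of the stopped iterates are false.\<close>

definition stop_indices ::
    "'a::euclidean_space set \<Rightarrow> nat \<Rightarrow> (nat \<Rightarrow> 'a \<Rightarrow> real) \<Rightarrow> nat set" where
  "stop_indices \<Omega> N x =
     {k. \<exists>q. k = q * N \<and> (\<forall>i\<le>N. AE t in lebesgue_on \<Omega>. x (k + i) t = x k t)}"

text \<open>Meaningful only if \<^term>\<open>stop_indices \<Omega> N x\<close> is nonempty, i.e.\ the stopping index is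
  finite.\<close>

definition stop_index ::
    "'a::euclidean_space set \<Rightarrow> nat \<Rightarrow> (nat \<Rightarrow> 'a \<Rightarrow> real) \<Rightarrow> nat" where
  "stop_index \<Omega> N x = (LEAST k. k \<in> stop_indices \<Omega> N x)"

end

theory Submission
  imports Defs "HOL-Complex_Analysis.Great_Picard"
begin

text \<open>
  Let \<open>x\<^sup>*\<close> be the nonnegative solution. By (A1) the operators preserve mass, so \<open>x\<^sup>*\<close> and all
  iterates are probability densities. An active step multiplies \<open>x\<^sub>k\<close> by \<open>\<omega>\<^sub>k\<close>, which at each \<open>t\<close> is
  the mean of the ratio \<open>r = y\<^sup>\<delta> / A x\<^sub>k\<close> with respect to the probability density \<open>a(\<cdot>, t)\<close>, and it
  lowers the distance \<open>d(x\<^sup>*, x\<^sub>k)\<close> by \<open>\<integral> x\<^sup>* ln \<omega>\<^sub>k\<close>. Since \<open>ln\<close> is concave,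
  \<open>\<integral> x\<^sup>* ln \<omega>\<^sub>k \<ge> \<integral> (A x\<^sup>*) ln r = \<integral> y ln r\<close>; and since \<open>m \<le> A x\<^sub>k \<le> M\<close> gives \<open>\<bar>ln r\<bar> \<le> \<gamma>\<close>,
  replacing \<open>y\<close> by \<open>y\<^sup>\<delta>\<close> costs at most \<open>\<gamma>\<delta>\<close>, so that \<open>\<integral> x\<^sup>* ln \<omega>\<^sub>k \<ge> f\<^sup>\<delta>(x\<^sub>k) - \<gamma>\<delta>\<close> (\<open>step_gain\<close>).
  The step is active only if \<open>f\<^sup>\<delta>(x\<^sub>k) > \<tau>\<gamma>\<delta>\<close>, hence every active step gains at least \<open>(\<tau> - 1)\<gamma>\<delta>\<close>,
  while all gains together are at most \<open>d(x\<^sup>*, x\<^sub>0)\<close> (\<open>energy\<close>).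

  Each cycle that changes the iterate contains an active step, which bounds the number of such cycles
  by \<open>d(x\<^sup>*, x\<^sub>0) / ((\<tau> - 1) \<gamma> min\<^sub>j \<delta>\<^sub>j)\<close>; this is (i) and (ii). An active step has positive gain and
  therefore really changes the iterate, so at the stopping index all \<open>N\<close> steps are idle, which
  says precisely that all residuals are at most \<open>\<tau>\<gamma>\<delta>\<^sub>j\<close>; this is (iii).

  For (iv), the Kullback--Leibler integrand of numbers in \<open>(0, C]\<close> dominates \<open>(v - u)\<^sup>2 / (4C)\<close>
  (\<open>KL_ge_square\<close>), so small residuals are small in \<open>L\<^sup>1\<close>; being bounded by \<open>M\<close>, they are
  small in every \<open>L\<^sup>p\<close>.

  For (v), weak sequential compactness of bounded nonnegative sequences in \<open>L\<^sup>p\<close> is proved directly. The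
  integrals over the sets of a countable generator converge along a diagonal subsequence; by
  uniform integrability they then converge for all measurable sets, and the limits form an absolutely
  continuous measure, whose Radon--Nikodym density is the weak limit \<open>z\<close>. The sections \<open>a(s, \<cdot>)\<close> are bounded,
  hence admissible test functions, so \<open>A x\<^sub>l \<longrightarrow> A z\<close> pointwise, whereas \<open>A x\<^sub>l \<longrightarrow> y\<close> in \<open>L\<^sup>1\<close> by
  (iv); thus \<open>A z = y\<close>.

  The kernels are only Lebesgue measurable on \<open>\<Sigma> \<times> \<Omega>\<close>, where Fubini's theorem for product
  measures does not apply literally. They are replaced by Borel versions that satisfy the bounds
  \<open>[m, M]\<close> everywhere (\<open>borel_regularisation\<close>), and the iteration with the original kernels is
  compared with them almost everywhere.
\<close>

section \<open>The Kullback--Leibler integrand\<close>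

lemma KL_integrand_pos: "0 < v \<Longrightarrow> 0 < u \<Longrightarrow> KL_integrand v u = ennreal (v * ln (v / u) - v + u)"
  by (simp add: KL_integrand_def)

text \<open>The squared Hellinger distance is a lower bound for the integrand: \<open>ln w \<le> w - 1\<close> at \<open>w = sqrt (u / v)\<close>.
  In particular the integrand is nonnegative.\<close>

lemma KL_ge_sqrt:
  fixes u v :: real
  assumes "0 < v" "0 < u"
  shows "(sqrt v - sqrt u)\<^sup>2 \<le> v * ln (v / u) - v + u"
proof -
  have "ln (sqrt (u / v)) \<le> sqrt (u / v) - 1"
    using assms by (intro ln_le_minus_one) simp
  moreover have "ln (sqrt (u / v)) = - ln (v / u) / 2"
    using assms by (simp add: ln_sqrt ln_div)
  ultimately have "2 - 2 * sqrt (u / v) \<le> ln (v / u)" by simp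
  then have "v * (2 - 2 * sqrt (u / v)) \<le> v * ln (v / u)"
    using assms by (intro mult_left_mono) auto
  moreover have "v * sqrt (u / v) = sqrt v * sqrt u"
    using assms by (simp add: real_sqrt_divide field_simps)
  ultimately show ?thesis
    using assms by (simp add: power2_eq_square algebra_simps)
qed

text \<open>Since \<open>v - u = (sqrt v - sqrt u) (sqrt v + sqrt u)\<close>, the Hellinger bound controls the squared
  difference of bounded arguments. This turns small residuals into small \<open>L\<^sup>1\<close> norms.\<close>

lemma KL_ge_square:
  fixes u v :: real
  assumes "0 < v" "v \<le> C" "0 < u" "u \<le> C"
  shows "(v - u)\<^sup>2 \<le> 4 * C * (v * ln (v / u) - v + u)"
proof -
  have "(sqrt v + sqrt u)\<^sup>2 \<le> (2 * sqrt C)\<^sup>2"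
  proof (rule power_mono)
    show "sqrt v + sqrt u \<le> 2 * sqrt C"
      using real_sqrt_le_mono[OF assms(2)] real_sqrt_le_mono[OF assms(4)] by linarith
  qed (use assms in simp)
  also have "\<dots> = 4 * C" using assms by (simp add: power_mult_distrib)
  finally have "(sqrt v + sqrt u)\<^sup>2 * (sqrt v - sqrt u)\<^sup>2 \<le> 4 * C * (v * ln (v / u) - v + u)"
    using KL_ge_sqrt[of v u] assms by (intro mult_mono) auto
  moreover have "(sqrt v + sqrt u) * (sqrt v - sqrt u) = v - u"
    using assms by (simp add: algebra_simps)
  ultimately show ?thesis by (metis power_mult_distrib)
qed

text \<open>For \<open>u > 0\<close> this is \<open>d(v, u exp e) \<ge> 0\<close> at the level of integrands. With \<open>u = x\<^sub>0\<close> and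
  \<open>u exp e = x\<^sub>n\<close> it bounds the total gain without ever referring to \<open>d(x\<^sup>*, x\<^sub>n)\<close>, whose
  finiteness would otherwise have to be carried along.\<close>

lemma KL_integrand_exp_shift:
  assumes "KL_integrand v u \<noteq> \<infinity>"
  shows "v * e \<le> enn2real (KL_integrand v u) - u + u * exp e"
proof -
  have v: "0 \<le> v" "0 \<le> u" "u = 0 \<longrightarrow> v = 0"
    using assms by (auto simp: KL_integrand_def split: if_splits)
  show ?thesis
  proof (cases "v = 0")
    case True
    then show ?thesis using v by (simp add: KL_integrand_def)
  next
    case False
    then have pos: "0 < v" "0 < u" using v by auto
    have nn: "0 \<le> v * ln (v / u) - v + u"
      using KL_ge_sqrt[OF pos] by (meson order_trans zero_le_power2)
    have "ln (u * exp e / v) \<le> u * exp e / v - 1"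
      using pos by (intro ln_le_minus_one) simp
    moreover have "ln (u * exp e / v) = e - ln (v / u)"
      using pos by (simp add: ln_div ln_mult)
    ultimately have "v * (e - ln (v / u)) \<le> v * (u * exp e / v - 1)"
      using pos by (intro mult_left_mono) auto
    then have "v * e \<le> v * ln (v / u) - v + u * exp e"
      using pos by (simp add: algebra_simps)
    then show ?thesis using pos nn by (simp add: KL_integrand_pos)
  qed
qed

section \<open>Integral operators whose kernel has unit mass\<close>

text \<open>The operator and its adjoint are defined for arbitrary measures, because the analysis of the iteration
  only uses Fubini's theorem and not the Lebesgue measure.\<close>

definition kernel_integral ::
    "'a measure \<Rightarrow> ('b \<Rightarrow> 'a \<Rightarrow> real) \<Rightarrow> ('a \<Rightarrow> real) \<Rightarrow> 'b \<Rightarrow> real" where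
  "kernel_integral P G x s = (\<integral>t. G s t * x t \<partial>P)"

definition adjoint_integral ::
    "'b measure \<Rightarrow> ('b \<Rightarrow> 'a \<Rightarrow> real) \<Rightarrow> ('b \<Rightarrow> real) \<Rightarrow> 'a \<Rightarrow> real" where
  "adjoint_integral Q G v t = (\<integral>s. G s t * v s \<partial>Q)"

definition prob_density :: "'a measure \<Rightarrow> ('a \<Rightarrow> real) \<Rightarrow> bool" where
  "prob_density P x \<longleftrightarrow> integrable P x \<and> (AE t in P. 0 \<le> x t) \<and> (\<integral>t. x t \<partial>P) = 1"

text \<open>The bounds are required everywhere and not only almost everywhere, so that every section of the
  kernel is an admissible integrand.\<close>

locale kernel_pair = P: finite_measure P + Q: finite_measure Q
  for P :: "'a measure" and Q :: "'b measure" +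
  fixes G :: "'b \<Rightarrow> 'a \<Rightarrow> real" and m M :: real
  assumes G_measurable: "(\<lambda>(s, t). G s t) \<in> borel_measurable (Q \<Otimes>\<^sub>M P)"
    and m_pos: "0 < m"
    and G_lower: "m \<le> G s t" and G_upper: "G s t \<le> M"
    and G_mass: "AE t in P. (\<integral>s. G s t \<partial>Q) = 1"
begin

abbreviation T :: "('a \<Rightarrow> real) \<Rightarrow> 'b \<Rightarrow> real" where
  "T \<equiv> kernel_integral P G"

abbreviation W :: "('b \<Rightarrow> real) \<Rightarrow> 'a \<Rightarrow> real" where
  "W \<equiv> adjoint_integral Q G"

lemma M_pos: "0 < M"
  using m_pos G_lower[of undefined undefined] G_upper[of undefined undefined] by linarith

lemma G_abs: "\<bar>G s t\<bar> \<le> M"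
  using m_pos G_lower[of s t] G_upper[of s t] by linarith

lemma G_comp [measurable (raw)]:
  assumes "f \<in> N \<rightarrow>\<^sub>M Q" "g \<in> N \<rightarrow>\<^sub>M P"
  shows "(\<lambda>w. G (f w) (g w)) \<in> borel_measurable N"
  using measurable_compose[OF measurable_Pair[OF assms] G_measurable] by simp

lemma T_measurable [measurable]:
  assumes [measurable]: "x \<in> borel_measurable P"
  shows "T x \<in> borel_measurable Q"
  unfolding kernel_integral_def by measurable

lemma W_measurable [measurable]:
  assumes [measurable]: "v \<in> borel_measurable Q"
  shows "W v \<in> borel_measurable P"
  unfolding adjoint_integral_def by measurable

lemma integrable_G_mult:
  assumes "integrable P x" "s \<in> space Q"
  shows "integrable P (\<lambda>t. G s t * x t)"
proof (rule Bochner_Integration.integrable_bound)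
  show "integrable P (\<lambda>t. M * x t)" using assms by simp
  have [measurable]: "x \<in> borel_measurable P" "s \<in> space Q" using assms by auto
  show "(\<lambda>t. G s t * x t) \<in> borel_measurable P" by measurable
  show "AE t in P. norm (G s t * x t) \<le> norm (M * x t)"
    using M_pos by (intro AE_I2) (simp add: abs_mult mult_right_mono G_abs)
qed

lemma integrable_bounded_Q:
  fixes v :: "'b \<Rightarrow> real"
  assumes "v \<in> borel_measurable Q" "AE s in Q. \<bar>v s\<bar> \<le> C"
  shows "integrable Q v"
  by (rule Q.integrable_const_bound[of _ C]) (use assms in auto)

lemma integrable_G_mult':
  assumes [measurable]: "v \<in> borel_measurable Q" and "AE s in Q. \<bar>v s\<bar> \<le> C" "t \<in> space P"
  shows "integrable Q (\<lambda>s. G s t * v s)"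
proof (rule Bochner_Integration.integrable_bound)
  show "integrable Q (\<lambda>t. M * v t)" using integrable_bounded_Q[OF assms(1,2)] by simp
  show "(\<lambda>s. G s t * v s) \<in> borel_measurable Q" using assms(3) by measurable
  show "AE s in Q. norm (G s t * v s) \<le> norm (M * v s)"
    using M_pos by (intro AE_I2) (simp add: abs_mult mult_right_mono G_abs)
qed

lemma T_bounds:
  assumes x: "integrable P x" "AE t in P. 0 \<le> x t" "(\<integral>t. x t \<partial>P) = 1" and s: "s \<in> space Q"
  shows "m \<le> T x s" "T x s \<le> M"
proof -
  have "(\<integral>t. m * x t \<partial>P) \<le> T x s"
    unfolding kernel_integral_def
    by (rule integral_mono_AE) (use x s in \<open>auto simp: integrable_G_mult intro: mult_right_mono[OF G_lower]\<close>)
  then show "m \<le> T x s" using x by simp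
  have "T x s \<le> (\<integral>t. M * x t \<partial>P)"
    unfolding kernel_integral_def
    by (rule integral_mono_AE) (use x s in \<open>auto simp: integrable_G_mult intro: mult_right_mono[OF G_upper]\<close>)
  then show "T x s \<le> M" using x by simp
qed

lemma integrable_G: "t \<in> space P \<Longrightarrow> integrable Q (\<lambda>s. G s t)"
  using integrable_bounded_Q[of "\<lambda>s. G s t" M] G_abs by simp

text \<open>The adjoint averages \<open>v\<close> against the probability densities \<open>G(\<cdot>, t)\<close>.\<close>

lemma W_bounds:
  assumes v [measurable]: "v \<in> borel_measurable Q" and b: "AE s in Q. c \<le> v s \<and> v s \<le> C"
  shows "AE t in P. c \<le> W v t \<and> W v t \<le> C"
  using G_mass AE_space
proof eventually_elim
  case (elim t)
  have ab: "AE s in Q. \<bar>v s\<bar> \<le> max \<bar>c\<bar> \<bar>C\<bar>" using b by eventually_elim auto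
  have pos: "0 \<le> G s t" for s using G_lower[of s t] m_pos by simp
  have "(\<integral>s. G s t * c \<partial>Q) \<le> W v t"
    unfolding adjoint_integral_def using b integrable_G[OF elim(2)] integrable_G_mult'[OF v ab elim(2)]
    by (intro integral_mono_AE) (auto intro: mult_left_mono pos)
  moreover have "W v t \<le> (\<integral>s. G s t * C \<partial>Q)"
    unfolding adjoint_integral_def using b integrable_G[OF elim(2)] integrable_G_mult'[OF v ab elim(2)]
    by (intro integral_mono_AE) (auto intro: mult_left_mono pos)
  ultimately show ?case using elim(1) integrable_G[OF elim(2)] by simp
qed

lemma duality:
  assumes x: "integrable P x" and v [measurable]: "v \<in> borel_measurable Q"
    and b: "AE s in Q. \<bar>v s\<bar> \<le> C"
  shows "(\<integral>s. v s * T x s \<partial>Q) = (\<integral>t. x t * W v t \<partial>P)"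
proof -
  interpret QP: pair_sigma_finite Q P ..
  have [measurable]: "x \<in> borel_measurable P" using x by simp
  have int: "integrable (Q \<Otimes>\<^sub>M P) (\<lambda>(s, t). v s * (G s t * x t))"
  proof (rule QP.Fubini_integrable)
    show "AE s in Q. integrable P (\<lambda>t. case (s, t) of (s, t) \<Rightarrow> v s * (G s t * x t))"
      using x by (auto intro!: AE_I2 integrable_G_mult)
    show "integrable Q (\<lambda>s. \<integral>t. norm (case (s, t) of (s, t) \<Rightarrow> v s * (G s t * x t)) \<partial>P)"
    proof (rule Q.integrable_const_bound[of _ "C * (\<integral>t. M * \<bar>x t\<bar> \<partial>P)"])
      show "AE s in Q. norm (\<integral>t. norm (case (s, t) of (s, t) \<Rightarrow> v s * (G s t * x t)) \<partial>P)
              \<le> C * (\<integral>t. M * \<bar>x t\<bar> \<partial>P)"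
        using b AE_space
      proof eventually_elim
        case (elim s)
        have "(\<integral>t. \<bar>G s t * x t\<bar> \<partial>P) \<le> (\<integral>t. M * \<bar>x t\<bar> \<partial>P)"
          using x integrable_abs[OF integrable_G_mult[OF x elim(2)]]
          by (intro integral_mono) (simp_all add: abs_mult mult_right_mono G_abs)
        then have "\<bar>v s\<bar> * (\<integral>t. \<bar>G s t * x t\<bar> \<partial>P) \<le> C * (\<integral>t. M * \<bar>x t\<bar> \<partial>P)"
          using elim(1) by (intro mult_mono) auto
        then show ?case by (simp add: abs_mult)
      qed
    qed measurable
  qed measurable
  have "(\<integral>s. v s * T x s \<partial>Q) = (\<integral>s. (\<integral>t. v s * (G s t * x t) \<partial>P) \<partial>Q)"
    unfolding kernel_integral_def by simp
  also have "\<dots> = (\<integral>t. (\<integral>s. v s * (G s t * x t) \<partial>Q) \<partial>P)"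
    using QP.Fubini_integral[OF int] by simp
  also have "\<dots> = (\<integral>t. x t * W v t \<partial>P)"
  proof (rule Bochner_Integration.integral_cong[OF refl])
    fix t
    have "(\<integral>s. v s * (G s t * x t) \<partial>Q) = (\<integral>s. x t * (G s t * v s) \<partial>Q)"
      by (simp add: algebra_simps)
    then show "(\<integral>s. v s * (G s t * x t) \<partial>Q) = x t * W v t" unfolding adjoint_integral_def by simp
  qed
  finally show ?thesis .
qed

lemma integral_T:
  assumes "integrable P x"
  shows "(\<integral>s. T x s \<partial>Q) = (\<integral>t. x t \<partial>P)"
proof -
  have "(\<integral>s. T x s \<partial>Q) = (\<integral>t. x t * W (\<lambda>_. 1) t \<partial>P)"
    using duality[OF assms, of "\<lambda>_. 1" 1] by simp
  also have "\<dots> = (\<integral>t. x t \<partial>P)"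
    using assms G_mass by (intro integral_cong_AE) (auto simp: adjoint_integral_def)
  finally show ?thesis .
qed

text \<open>Jensen's inequality for \<open>ln\<close> and the probability density \<open>G(\<cdot>, t)\<close>. With \<open>w\<close> the mean of
  \<open>v\<close>, it is the integral of the tangent inequality \<open>ln v \<le> ln w + v / w - 1\<close>.\<close>

lemma W_ln_le:
  assumes v [measurable]: "v \<in> borel_measurable Q" and c: "0 < c"
    and b: "AE s in Q. c \<le> v s \<and> v s \<le> C"
  shows "AE t in P. W (\<lambda>s. ln (v s)) t \<le> ln (W v t)"
  using G_mass W_bounds[OF v b] AE_space
proof eventually_elim
  case (elim t)
  define w where "w = W v t"
  have w: "0 < w" using elim c by (simp add: w_def)
  have pos: "0 \<le> G s t" for s using G_lower[of s t] m_pos by simp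
  have ab: "AE s in Q. \<bar>v s\<bar> \<le> max \<bar>c\<bar> \<bar>C\<bar>" using b by eventually_elim auto
  have lab: "AE s in Q. \<bar>ln (v s)\<bar> \<le> max \<bar>ln c\<bar> \<bar>ln C\<bar>"
    using b
  proof eventually_elim
    case (elim s)
    then have "ln c \<le> ln (v s)" "ln (v s) \<le> ln C" using c by auto
    then show ?case by auto
  qed
  have iv: "integrable Q (\<lambda>s. G s t * v s)" by (rule integrable_G_mult'[OF v ab elim(3)])
  have il: "integrable Q (\<lambda>s. G s t * ln (v s))" by (rule integrable_G_mult'[OF _ lab elim(3)]) measurable
  have "(\<integral>s. G s t * ln (v s) \<partial>Q) \<le> (\<integral>s. (ln w - 1) * G s t + (1 / w) * (G s t * v s) \<partial>Q)"
  proof (rule integral_mono_AE)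
    show "AE s in Q. G s t * ln (v s) \<le> (ln w - 1) * G s t + 1 / w * (G s t * v s)"
      using b
    proof eventually_elim
      case (elim s)
      then have "ln (v s) - ln w \<le> v s / w - 1"
        using c w ln_le_minus_one[of "v s / w"] by (simp add: ln_div)
      then have "G s t * ln (v s) \<le> G s t * (ln w - 1 + v s / w)" by (intro mult_left_mono pos) simp
      then show ?case by (simp add: algebra_simps)
    qed
  qed (use il iv integrable_G[OF elim(3)] in auto)
  also have "\<dots> = (ln w - 1) * 1 + (1 / w) * w"
    using iv integrable_G[OF elim(3)] elim(1) by (simp add: adjoint_integral_def w_def)
  finally show ?case using w by (simp add: adjoint_integral_def w_def)
qed

lemma prob_density_T_bounds:
  assumes "prob_density P x" "s \<in> space Q"
  shows "m \<le> T x s" "T x s \<le> M"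
  using assms T_bounds[of x s] by (auto simp: prob_density_def)

lemma ratio_bounds:
  assumes x: "prob_density P x" and m1: "0 < m1"
    and b: "AE s in Q. m1 \<le> yd s \<and> yd s \<le> M1"
  shows "AE s in Q. m1 / M \<le> yd s / T x s \<and> yd s / T x s \<le> M1 / m"
  using b AE_space
proof eventually_elim
  case (elim s)
  note T = prob_density_T_bounds[OF x elim(2)]
  have "0 < T x s" using T m_pos by linarith
  then show ?case
    using T m_pos m1 elim by (intro conjI frac_le) auto
qed

text \<open>The multiplicative update produces an iterate with the mass of the data:
  \<open>\<integral> x W(y / T x) = \<integral> (y / T x) T x\<close> by duality.\<close>

lemma step_mass:
  assumes x: "prob_density P x" and m1: "0 < m1"
    and yd [measurable]: "yd \<in> borel_measurable Q"
    and b: "AE s in Q. m1 \<le> yd s \<and> yd s \<le> M1"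
  shows "(\<integral>t. x t * W (\<lambda>s. yd s / T x s) t \<partial>P) = (\<integral>s. yd s \<partial>Q)"
proof -
  have [measurable]: "x \<in> borel_measurable P" and ix: "integrable P x"
    using x by (auto simp: prob_density_def)
  have rb: "AE s in Q. \<bar>yd s / T x s\<bar> \<le> M1 / m"
    using ratio_bounds[OF x m1 b] m1 M_pos
    by (elim eventually_mono) (smt (verit) divide_pos_pos)
  have "(\<integral>t. x t * W (\<lambda>s. yd s / T x s) t \<partial>P) = (\<integral>s. yd s / T x s * T x s \<partial>Q)"
    by (rule duality[OF ix _ rb, symmetric]) measurable
  also have "\<dots> = (\<integral>s. yd s \<partial>Q)"
    using prob_density_T_bounds(1)[OF x] m_pos
    by (intro Bochner_Integration.integral_cong) (auto, force)
  finally show ?thesis .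
qed

lemma ln_ratio_bound:
  assumes x: "prob_density P x" and m1: "0 < m1"
    and b: "AE s in Q. m1 \<le> yd s \<and> yd s \<le> M1"
  shows "AE s in Q. \<bar>ln (yd s / T x s)\<bar> \<le> max \<bar>ln (m1 / M)\<bar> \<bar>ln (M1 / m)\<bar>"
  using ratio_bounds[OF x m1 b]
proof eventually_elim
  case (elim s)
  have "0 < m1 / M" using m1 M_pos by simp
  then have "ln (m1 / M) \<le> ln (yd s / T x s)" "ln (yd s / T x s) \<le> ln (M1 / m)"
    using elim by (auto intro!: ln_mono)
  then show ?case by auto
qed

text \<open>As \<open>y\<close> and \<open>T x\<close> both have mass one, the terms \<open>- y + T x\<close> cancel in the integral, so the
  extended-valued distance is an ordinary integral.\<close>

lemma step_KL:
  assumes x: "prob_density P x" and m1: "0 < m1"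
    and yd: "prob_density Q yd"
    and b: "AE s in Q. m1 \<le> yd s \<and> yd s \<le> M1"
  shows "(\<integral>\<^sup>+ s. KL_integrand (yd s) (T x s) \<partial>Q) = ennreal (\<integral>s. yd s * ln (yd s / T x s) \<partial>Q)"
    "integrable Q (\<lambda>s. yd s * ln (yd s / T x s))"
    "AE s in Q. 0 \<le> yd s * ln (yd s / T x s) - yd s + T x s"
    "(\<integral>s. yd s * ln (yd s / T x s) - yd s + T x s \<partial>Q) = (\<integral>s. yd s * ln (yd s / T x s) \<partial>Q)"
    "integrable Q (\<lambda>s. yd s * ln (yd s / T x s) - yd s + T x s)"
proof -
  have [measurable]: "x \<in> borel_measurable P" "yd \<in> borel_measurable Q" and ix: "integrable P x"
    and iy: "integrable Q yd"
    using x yd by (auto simp: prob_density_def)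
  define g where "g = max \<bar>ln (m1 / M)\<bar> \<bar>ln (M1 / m)\<bar>"
  have iT: "integrable Q (T x)"
  proof (rule integrable_bounded_Q)
    show "AE s in Q. \<bar>T x s\<bar> \<le> M"
      using prob_density_T_bounds[OF x] m_pos by (intro AE_I2) force
  qed measurable
  show i: "integrable Q (\<lambda>s. yd s * ln (yd s / T x s))"
  proof (rule Bochner_Integration.integrable_bound)
    show "integrable Q (\<lambda>s. g * yd s)" using iy by simp
    show "AE s in Q. norm (yd s * ln (yd s / T x s)) \<le> norm (g * yd s)"
      using ln_ratio_bound[OF x m1 b] b
    proof eventually_elim
      case (elim s)
      then have "\<bar>ln (yd s / T x s)\<bar> * \<bar>yd s\<bar> \<le> \<bar>g\<bar> * \<bar>yd s\<bar>"
        unfolding g_def by (intro mult_right_mono) auto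
      then show ?case by (simp add: abs_mult mult.commute)
    qed
  qed measurable
  show nn: "AE s in Q. 0 \<le> yd s * ln (yd s / T x s) - yd s + T x s"
    using b AE_space
  proof eventually_elim
    case (elim s)
    then show ?case
      using KL_ge_sqrt[of "yd s" "T x s"] prob_density_T_bounds(1)[OF x elim(2)] m1 m_pos
      by (smt (verit) zero_le_power2)
  qed
  show i2: "integrable Q (\<lambda>s. yd s * ln (yd s / T x s) - yd s + T x s)"
    using i iy iT by simp
  have "(\<integral>s. T x s \<partial>Q) = 1" using integral_T[OF ix] x by (simp add: prob_density_def)
  then show eq: "(\<integral>s. yd s * ln (yd s / T x s) - yd s + T x s \<partial>Q) = (\<integral>s. yd s * ln (yd s / T x s) \<partial>Q)"
    using i iy iT yd by (simp add: prob_density_def)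
  have "(\<integral>\<^sup>+ s. KL_integrand (yd s) (T x s) \<partial>Q)
      = (\<integral>\<^sup>+ s. ennreal (yd s * ln (yd s / T x s) - yd s + T x s) \<partial>Q)"
  proof (rule nn_integral_cong_AE)
    show "AE s in Q. KL_integrand (yd s) (T x s) = ennreal (yd s * ln (yd s / T x s) - yd s + T x s)"
      using b AE_space
    proof eventually_elim
      case (elim s)
      then show ?case
        using prob_density_T_bounds(1)[OF x elim(2)] m1 m_pos by (intro KL_integrand_pos) auto
    qed
  qed
  also have "\<dots> = ennreal (\<integral>s. yd s * ln (yd s / T x s) - yd s + T x s \<partial>Q)"
    by (rule nn_integral_eq_integral[OF i2 nn])
  finally show "(\<integral>\<^sup>+ s. KL_integrand (yd s) (T x s) \<partial>Q) = ennreal (\<integral>s. yd s * ln (yd s / T x s) \<partial>Q)"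
    by (simp add: eq)
qed

text \<open>The heart of the argument: the quantity \<open>\<integral> x\<^sup>* ln \<omega>\<close> gained by one update is at least the residual
  minus the noise. Jensen's inequality and duality move the logarithm to the data side, where
  \<open>T x\<^sup>* = y\<close>; exchanging \<open>y\<close> for the noisy data costs at most \<open>g d\<close>, because the logarithm
  is bounded by \<open>g\<close>.\<close>

lemma step_gain:
  assumes x: "prob_density P x" and m1: "0 < m1"
    and yd: "prob_density Q yd"
    and b: "AE s in Q. m1 \<le> yd s \<and> yd s \<le> M1"
    and y: "integrable Q y" and noise: "(\<integral>s. \<bar>y s - yd s\<bar> \<partial>Q) \<le> d"
    and xs: "integrable P xs" "AE t in P. 0 \<le> xs t" "AE s in Q. T xs s = y s"
    and g: "g = max \<bar>ln (m1 / M)\<bar> \<bar>ln (M1 / m)\<bar>"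
  shows "(\<integral>s. yd s * ln (yd s / T x s) \<partial>Q) - g * d
     \<le> (\<integral>t. xs t * ln (W (\<lambda>s. yd s / T x s) t) \<partial>P)"
proof -
  define v where "v = (\<lambda>s. yd s / T x s)"
  have [measurable]: "x \<in> borel_measurable P" "yd \<in> borel_measurable Q"
     "y \<in> borel_measurable Q" "xs \<in> borel_measurable P" and iy: "integrable Q yd"
    using x yd y xs by (auto simp: prob_density_def)
  have vm [measurable]: "v \<in> borel_measurable Q" unfolding v_def by measurable
  have g0: "0 \<le> g" using g by auto
  have c0: "0 < m1 / M" using m1 M_pos by simp
  have vb: "AE s in Q. m1 / M \<le> v s \<and> v s \<le> M1 / m"
    unfolding v_def by (rule ratio_bounds[OF x m1 b])
  have lv: "AE s in Q. \<bar>ln (v s)\<bar> \<le> g"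
    unfolding v_def g by (rule ln_ratio_bound[OF x m1 b])
  have lvm: "(\<lambda>s. ln (v s)) \<in> borel_measurable Q" by measurable
  have iyl: "integrable Q (\<lambda>s. yd s * ln (v s))"
    unfolding v_def by (rule step_KL(2)[OF x m1 yd b])
  have idl: "integrable Q (\<lambda>s. (y s - yd s) * ln (v s))"
  proof (rule Bochner_Integration.integrable_bound)
    show "integrable Q (\<lambda>s. g * (y s - yd s))" using iy y by simp
    show "AE s in Q. norm ((y s - yd s) * ln (v s)) \<le> norm (g * (y s - yd s))"
      using lv
    proof eventually_elim
      case (elim s)
      then have "\<bar>ln (v s)\<bar> * \<bar>y s - yd s\<bar> \<le> \<bar>g\<bar> * \<bar>y s - yd s\<bar>" by (intro mult_right_mono) auto
      then show ?case by (simp add: abs_mult mult.commute)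
    qed
  qed measurable
  \<comment> \<open>The price for replacing \<open>y\<close> by the noisy data.\<close>
  have "- (g * d) \<le> - (\<integral>s. g * \<bar>y s - yd s\<bar> \<partial>Q)"
    using noise g0 by (simp add: mult_left_mono)
  also have "\<dots> = (\<integral>s. - (g * \<bar>y s - yd s\<bar>) \<partial>Q)" by simp
  also have "\<dots> \<le> (\<integral>s. (y s - yd s) * ln (v s) \<partial>Q)"
  proof (rule integral_mono_AE)
    show "AE s in Q. - (g * \<bar>y s - yd s\<bar>) \<le> (y s - yd s) * ln (v s)"
      using lv
    proof eventually_elim
      case (elim s)
      then have "\<bar>ln (v s)\<bar> * \<bar>y s - yd s\<bar> \<le> g * \<bar>y s - yd s\<bar>" by (intro mult_right_mono) auto
      then have "\<bar>(y s - yd s) * ln (v s)\<bar> \<le> g * \<bar>y s - yd s\<bar>" by (simp add: abs_mult mult.commute)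
      then show ?case by linarith
    qed
  qed (use iy y idl in auto)
  finally have "(\<integral>s. yd s * ln (v s) \<partial>Q) - g * d
      \<le> (\<integral>s. yd s * ln (v s) \<partial>Q) + (\<integral>s. (y s - yd s) * ln (v s) \<partial>Q)" by simp
  also have "\<dots> = (\<integral>s. yd s * ln (v s) + (y s - yd s) * ln (v s) \<partial>Q)"
    using iyl idl by simp
  also have "\<dots> = (\<integral>s. ln (v s) * T xs s \<partial>Q)"
    using xs(3) by (intro integral_cong_AE) (auto simp: algebra_simps)
  also have "\<dots> = (\<integral>t. xs t * W (\<lambda>s. ln (v s)) t \<partial>P)"
    by (rule duality[OF xs(1) lvm lv])
  also have "\<dots> \<le> (\<integral>t. xs t * ln (W v t) \<partial>P)"
  proof (rule integral_mono_AE)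
    have Wl: "AE t in P. - g \<le> W (\<lambda>s. ln (v s)) t \<and> W (\<lambda>s. ln (v s)) t \<le> g"
      using lv by (intro W_bounds[OF lvm]) (auto elim: eventually_mono)
    show "integrable P (\<lambda>t. xs t * W (\<lambda>s. ln (v s)) t)"
    proof (rule Bochner_Integration.integrable_bound)
      show "integrable P (\<lambda>t. g * xs t)" using xs by simp
      show "AE t in P. norm (xs t * W (\<lambda>s. ln (v s)) t) \<le> norm (g * xs t)"
        using Wl
      proof eventually_elim
        case (elim t)
        then have "\<bar>W (\<lambda>s. ln (v s)) t\<bar> * \<bar>xs t\<bar> \<le> \<bar>g\<bar> * \<bar>xs t\<bar>" by (intro mult_right_mono) auto
        then show ?case by (simp add: abs_mult mult.commute)
      qed
    qed measurable
    show "integrable P (\<lambda>t. xs t * ln (W v t))"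
    proof (rule Bochner_Integration.integrable_bound)
      show "integrable P (\<lambda>t. g * xs t)" using xs by simp
      show "AE t in P. norm (xs t * ln (W v t)) \<le> norm (g * xs t)"
        using W_bounds[OF vm vb]
      proof eventually_elim
        case (elim t)
        then have "ln (m1 / M) \<le> ln (W v t)" "ln (W v t) \<le> ln (M1 / m)"
          using c0 by (auto intro!: ln_mono)
        then have "\<bar>ln (W v t)\<bar> \<le> \<bar>g\<bar>" using g by auto
        then have "\<bar>ln (W v t)\<bar> * \<bar>xs t\<bar> \<le> \<bar>g\<bar> * \<bar>xs t\<bar>" by (intro mult_right_mono) auto
        then show ?case by (simp add: abs_mult mult.commute)
      qed
    qed measurable
    show "AE t in P. xs t * W (\<lambda>s. ln (v s)) t \<le> xs t * ln (W v t)"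
      using xs(2) W_ln_le[OF vm c0 vb] by eventually_elim (auto intro: mult_left_mono)
  qed
  finally show ?thesis unfolding v_def .
qed

end

section \<open>The loping iteration\<close>

text \<open>One run of the iteration for fixed noisy data. The active steps are prescribed only almost
  everywhere, so that the locale also covers an iteration whose kernels agree with \<open>G\<close> almost everywhere;
  idle steps leave the representative unchanged, which makes the residual at the start of an idle cycle
  equal to the residuals tested within the cycle.\<close>

locale loping_run = P: finite_measure P + Q: finite_measure Q
  for P :: "'a measure" and Q :: "'b measure" +
  fixes N :: nat and G :: "nat \<Rightarrow> 'b \<Rightarrow> 'a \<Rightarrow> real" and y yd :: "nat \<Rightarrow> 'b \<Rightarrow> real"
    and \<delta> :: "nat \<Rightarrow> real" and m M m1 M1 \<tau> \<gamma> :: real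
    and xs :: "'a \<Rightarrow> real" and X :: "nat \<Rightarrow> 'a \<Rightarrow> real"
  assumes N: "0 < N"
    and kernel: "\<And>j. j < N \<Longrightarrow> kernel_pair P Q (G j) m M"
    and m1: "0 < m1" and \<tau>: "1 < \<tau>"
    and \<gamma>: "\<gamma> = max \<bar>ln (m1 / M)\<bar> \<bar>ln (M1 / m)\<bar>"
    and y: "\<And>j. j < N \<Longrightarrow> integrable Q (y j)"
    and yd: "\<And>j. j < N \<Longrightarrow> prob_density Q (yd j)"
    and yd_bounds: "\<And>j. j < N \<Longrightarrow> AE s in Q. m1 \<le> yd j s \<and> yd j s \<le> M1"
    and \<delta>: "\<And>j. j < N \<Longrightarrow> 0 < \<delta> j"
    and noise: "\<And>j. j < N \<Longrightarrow> (\<integral>s. \<bar>y j s - yd j s\<bar> \<partial>Q) \<le> \<delta> j"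
    and xs: "prob_density P xs"
    and solves: "\<And>j. j < N \<Longrightarrow> AE s in Q. kernel_integral P (G j) xs s = y j s"
    and start: "prob_density P (X 0)"
    and KL_start: "(\<integral>\<^sup>+ t. KL_integrand (xs t) (X 0 t) \<partial>P) < \<infinity>"
    and active_step: "\<And>k. ennreal (\<tau> * \<gamma> * \<delta> (k mod N))
        < (\<integral>\<^sup>+ s. KL_integrand (yd (k mod N) s) (kernel_integral P (G (k mod N)) (X k) s) \<partial>Q) \<Longrightarrow>
        AE t in P. X (Suc k) t = X k t * adjoint_integral Q (G (k mod N))
           (\<lambda>s. yd (k mod N) s / kernel_integral P (G (k mod N)) (X k) s) t"
    and idle_step: "\<And>k. \<not> ennreal (\<tau> * \<gamma> * \<delta> (k mod N))
        < (\<integral>\<^sup>+ s. KL_integrand (yd (k mod N) s) (kernel_integral P (G (k mod N)) (X k) s) \<partial>Q) \<Longrightarrow>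
        X (Suc k) = X k"
    and X_measurable: "\<And>k. X k \<in> borel_measurable P"
begin

definition KL :: "nat \<Rightarrow> nat \<Rightarrow> ennreal" where
  "KL j k = (\<integral>\<^sup>+ s. KL_integrand (yd j s) (kernel_integral P (G j) (X k) s) \<partial>Q)"

definition active :: "nat \<Rightarrow> bool" where
  "active k \<longleftrightarrow> ennreal (\<tau> * \<gamma> * \<delta> (k mod N)) < KL (k mod N) k"

definition ratio :: "nat \<Rightarrow> 'b \<Rightarrow> real" where
  "ratio k s = yd (k mod N) s / kernel_integral P (G (k mod N)) (X k) s"

definition factor :: "nat \<Rightarrow> 'a \<Rightarrow> real" where
  "factor k t = (if active k then adjoint_integral Q (G (k mod N)) (ratio k) t else 1)"

lemma mod_N_less [simp]: "k mod N < N"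
  using N by simp

lemma X_Suc: "AE t in P. X (Suc k) t = X k t * factor k t"
proof (cases "active k")
  case True
  then show ?thesis
    using active_step[of k] by (simp add: factor_def active_def KL_def ratio_def[abs_def])
next
  case False
  then have "X (Suc k) = X k" using idle_step[of k] by (simp add: active_def KL_def)
  with False show ?thesis by (simp add: factor_def)
qed

lemma idle_unchanged: "\<not> active k \<Longrightarrow> X (Suc k) = X k"
  using idle_step[of k] by (simp add: active_def KL_def)

lemma yd_measurable [measurable]: "j < N \<Longrightarrow> yd j \<in> borel_measurable Q"
  using yd by (auto simp: prob_density_def)

lemma \<gamma>_nonneg: "0 \<le> \<gamma>"
  by (simp add: \<gamma>)

lemma ratio_measurable [measurable]: "ratio k \<in> borel_measurable Q"
proof -
  interpret K: kernel_pair P Q "G (k mod N)" m M by (rule kernel) simp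
  note X_measurable[measurable]
  have [measurable]: "yd (k mod N) \<in> borel_measurable Q" by (rule yd_measurable) simp
  show ?thesis unfolding ratio_def by measurable
qed

lemma factor_measurable [measurable]: "factor k \<in> borel_measurable P"
proof -
  interpret K: kernel_pair P Q "G (k mod N)" m M by (rule kernel) simp
  show ?thesis by (cases "active k") (simp_all add: factor_def[abs_def])
qed

lemma const_pos: "0 < m1 / M"
proof -
  interpret K: kernel_pair P Q "G 0" m M by (rule kernel) (rule N)
  show ?thesis using K.M_pos m1 by simp
qed

lemma factor_bounds:
  assumes x: "prob_density P (X k)"
  shows "AE t in P. 0 < factor k t \<and> \<bar>ln (factor k t)\<bar> \<le> \<gamma>
    \<and> (active k \<longrightarrow> m1 / M \<le> factor k t \<and> factor k t \<le> M1 / m)"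
proof (cases "active k")
  case True
  interpret K: kernel_pair P Q "G (k mod N)" m M by (rule kernel) simp
  have "AE s in Q. m1 / M \<le> ratio k s \<and> ratio k s \<le> M1 / m"
    unfolding ratio_def by (rule K.ratio_bounds[OF x m1 yd_bounds]) simp
  from K.W_bounds[OF ratio_measurable this] show ?thesis
  proof eventually_elim
    case (elim t)
    then have f: "m1 / M \<le> factor k t" "factor k t \<le> M1 / m" by (auto simp: factor_def True)
    then have "0 < factor k t" using const_pos by linarith
    then have "ln (m1 / M) \<le> ln (factor k t)" "ln (factor k t) \<le> ln (M1 / m)"
      using f const_pos by (auto intro!: ln_mono)
    then have "\<bar>ln (factor k t)\<bar> \<le> \<gamma>" unfolding \<gamma> by linarith
    with f \<open>0 < factor k t\<close> show ?case by blast
  qed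
next
  case False
  then show ?thesis by (simp add: factor_def \<gamma>_nonneg)
qed

lemma X_density: "prob_density P (X k)"
proof (induction k)
  case 0
  show ?case by (rule start)
next
  case (Suc k)
  note X_measurable[measurable]
  show ?case
  proof (cases "active k")
    case True
    interpret K: kernel_pair P Q "G (k mod N)" m M by (rule kernel) simp
    have i: "integrable P (\<lambda>t. X k t * factor k t)"
    proof (rule Bochner_Integration.integrable_bound)
      show "integrable P (\<lambda>t. M1 / m * X k t)" using Suc by (simp add: prob_density_def)
      show "AE t in P. norm (X k t * factor k t) \<le> norm (M1 / m * X k t)"
        using factor_bounds[OF Suc]
      proof eventually_elim
        case (elim t)
        with True have "0 < factor k t" "factor k t \<le> M1 / m" by auto
        then have "\<bar>factor k t\<bar> \<le> \<bar>M1 / m\<bar>" by linarith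
        then have "\<bar>factor k t\<bar> * \<bar>X k t\<bar> \<le> \<bar>M1 / m\<bar> * \<bar>X k t\<bar>" by (rule mult_right_mono) simp
        then show ?case by (simp add: abs_mult mult.commute)
      qed
    qed measurable
    have "integrable P (X (Suc k)) \<longleftrightarrow> integrable P (\<lambda>t. X k t * factor k t)"
      by (rule integrable_cong_AE) (use X_Suc in auto)
    moreover have "AE t in P. 0 \<le> X k t" using Suc by (simp add: prob_density_def)
    then have "AE t in P. 0 \<le> X (Suc k) t"
      using X_Suc[of k] factor_bounds[OF Suc] by eventually_elim auto
    moreover have "(\<integral>t. X (Suc k) t \<partial>P) = (\<integral>t. X k t * factor k t \<partial>P)"
      by (rule integral_cong_AE) (use X_Suc in auto)
    moreover have "(\<integral>t. X k t * factor k t \<partial>P) = (\<integral>s. yd (k mod N) s \<partial>Q)"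
      using K.step_mass[OF Suc m1 yd_measurable yd_bounds] True
      by (simp add: factor_def ratio_def[abs_def])
    moreover have "\<dots> = 1" using yd[of "k mod N"] by (simp add: prob_density_def)
    ultimately show ?thesis using i by (simp add: prob_density_def)
  qed (use Suc idle_unchanged in simp)
qed

lemma KL_eq:
  assumes "j < N"
  shows "KL j k = ennreal (\<integral>s. yd j s * ln (yd j s / kernel_integral P (G j) (X k) s) \<partial>Q)"
proof -
  interpret K: kernel_pair P Q "G j" m M by (rule kernel) fact
  show ?thesis
    unfolding KL_def by (rule K.step_KL(1)[OF X_density m1 yd yd_bounds]) fact+
qed

text \<open>Every residual is at most \<open>\<gamma>\<close> because \<open>\<bar>ln r\<bar> \<le> \<gamma>\<close>; so \<open>\<gamma> = 0\<close> forces all residuals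
  to vanish and no step can be active.\<close>

lemma active_\<gamma>_pos:
  assumes "active k"
  shows "0 < \<gamma>"
proof -
  interpret K: kernel_pair P Q "G (k mod N)" m M by (rule kernel) simp
  let ?r = "\<lambda>s. yd (k mod N) s / kernel_integral P (G (k mod N)) (X k) s"
  have lb: "AE s in Q. \<bar>ln (?r s)\<bar> \<le> \<gamma>"
    unfolding \<gamma> by (rule K.ln_ratio_bound[OF X_density m1 yd_bounds]) simp
  have "(\<integral>s. yd (k mod N) s * ln (?r s) \<partial>Q) \<le> (\<integral>s. yd (k mod N) s * \<gamma> \<partial>Q)"
  proof (rule integral_mono_AE)
    show "integrable Q (\<lambda>s. yd (k mod N) s * ln (?r s))"
      by (rule K.step_KL(2)[OF X_density m1 yd yd_bounds]) simp_all
    show "integrable Q (\<lambda>s. yd (k mod N) s * \<gamma>)"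
      using yd[of "k mod N"] by (simp add: prob_density_def)
    show "AE s in Q. yd (k mod N) s * ln (?r s) \<le> yd (k mod N) s * \<gamma>"
      using lb yd_bounds[OF mod_N_less[of k]] by eventually_elim (use m1 in \<open>auto intro!: mult_left_mono\<close>)
  qed
  also have "\<dots> = \<gamma>" using yd[of "k mod N"] by (simp add: prob_density_def)
  finally have "KL (k mod N) k \<le> ennreal \<gamma>" by (simp add: KL_eq ennreal_leI)
  with assms have "ennreal (\<tau> * \<gamma> * \<delta> (k mod N)) < ennreal \<gamma>" unfolding active_def by order
  then show ?thesis using \<gamma>_nonneg \<tau> \<delta>[of "k mod N"]
    by (cases "\<gamma> = 0") auto
qed

definition gain :: "nat \<Rightarrow> real" where
  "gain k = (\<integral>t. xs t * ln (factor k t) \<partial>P)"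

lemma gain_idle: "\<not> active k \<Longrightarrow> gain k = 0"
  by (simp add: gain_def factor_def)

lemma gain_active:
  assumes "active k"
  shows "(\<tau> - 1) * \<gamma> * \<delta> (k mod N) \<le> gain k"
proof -
  interpret K: kernel_pair P Q "G (k mod N)" m M by (rule kernel) simp
  let ?E = "\<integral>s. yd (k mod N) s * ln (yd (k mod N) s / kernel_integral P (G (k mod N)) (X k) s) \<partial>Q"
  have "ennreal (\<tau> * \<gamma> * \<delta> (k mod N)) < ennreal ?E"
    using assms by (simp add: active_def KL_eq)
  then have "\<tau> * \<gamma> * \<delta> (k mod N) \<le> ?E"
    by (metis ennreal_leI not_le order_less_imp_le)
  moreover have "?E - \<gamma> * \<delta> (k mod N) \<le> gain k"
    using K.step_gain[OF X_density m1 yd yd_bounds y noise _ _ solves \<gamma>] xs assms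
    by (simp add: gain_def factor_def ratio_def[abs_def] prob_density_def)
  ultimately show ?thesis by (simp add: algebra_simps)
qed

text \<open>If the factor were one wherever \<open>x\<^sup>*\<close> is nonzero, the gain would vanish; but an active step has
  positive gain.\<close>

lemma active_changes:
  assumes "active k" shows "\<not> (AE t in P. xs t = 0 \<or> factor k t = 1)"
proof
  assume ae: "AE t in P. xs t = 0 \<or> factor k t = 1"
  have [measurable]: "xs \<in> borel_measurable P" using xs by (auto simp: prob_density_def)
  have "gain k = (\<integral>t. 0 \<partial>P)"
    unfolding gain_def by (rule integral_cong_AE) (use ae in \<open>auto elim!: eventually_mono\<close>)
  moreover have "0 < (\<tau> - 1) * \<gamma> * \<delta> (k mod N)"
    using active_\<gamma>_pos[OF assms] \<tau> \<delta>[of "k mod N"] by simp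
  ultimately show False using gain_active[OF assms] by simp
qed

definition log_factor :: "nat \<Rightarrow> 'a \<Rightarrow> real" where
  "log_factor n t = (\<Sum>k<n. ln (factor k t))"

lemma X_exp: "AE t in P. X n t = X 0 t * exp (log_factor n t)"
proof (induction n)
  case 0
  then show ?case by (simp add: log_factor_def)
next
  case (Suc n)
  then show ?case
    using X_Suc[of n] factor_bounds[OF X_density[of n]]
    by eventually_elim (simp add: log_factor_def exp_add)
qed

lemma KL_start_AE: "AE t in P. KL_integrand (xs t) (X 0 t) \<noteq> \<infinity>"
proof (rule nn_integral_PInf_AE)
  have [measurable]: "xs \<in> borel_measurable P" using xs by (auto simp: prob_density_def)
  note X_measurable[measurable]
  show "(\<lambda>t. KL_integrand (xs t) (X 0 t)) \<in> borel_measurable P"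
    unfolding KL_integrand_def by measurable
qed (use KL_start in auto)

lemma xs_ln_factor_integrable: "integrable P (\<lambda>t. xs t * ln (factor k t))"
proof (rule Bochner_Integration.integrable_bound)
  show "integrable P (\<lambda>t. \<gamma> * xs t)" using xs by (simp add: prob_density_def)
  show "(\<lambda>t. xs t * ln (factor k t)) \<in> borel_measurable P"
    using xs by (auto simp: prob_density_def)
  show "AE t in P. norm (xs t * ln (factor k t)) \<le> norm (\<gamma> * xs t)"
    using factor_bounds[OF X_density[of k]]
  proof eventually_elim
    case (elim t)
    then have "\<bar>ln (factor k t)\<bar> * \<bar>xs t\<bar> \<le> \<bar>\<gamma>\<bar> * \<bar>xs t\<bar>" by (intro mult_right_mono) auto
    then show ?case by (simp add: abs_mult mult.commute)
  qed
qed

text \<open>The gains telescope: their sum is \<open>\<integral> x\<^sup>* ln (x\<^sub>n / x\<^sub>0)\<close>, and nonnegativity of \<open>d(x\<^sup>*, x\<^sub>n)\<close>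
  bounds this by \<open>d(x\<^sup>*, x\<^sub>0)\<close>, as \<open>x\<^sub>0\<close> and \<open>x\<^sub>n\<close> have the same mass.\<close>

theorem energy: "(\<Sum>k<n. gain k) \<le> enn2real (\<integral>\<^sup>+ t. KL_integrand (xs t) (X 0 t) \<partial>P)"
proof -
  have [measurable]: "xs \<in> borel_measurable P" using xs by (auto simp: prob_density_def)
  note X_measurable[measurable]
  define D where "D = (\<lambda>t. enn2real (KL_integrand (xs t) (X 0 t)))"
  have Dm [measurable]: "D \<in> borel_measurable P"
    unfolding D_def KL_integrand_def by measurable
  have "(\<integral>\<^sup>+ t. ennreal (D t) \<partial>P) = (\<integral>\<^sup>+ t. KL_integrand (xs t) (X 0 t) \<partial>P)"
    unfolding D_def by (rule nn_integral_cong_AE)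
      (use KL_start_AE in \<open>auto elim!: eventually_mono simp: less_top\<close>)
  moreover have D0: "\<And>t. 0 \<le> D t" by (simp add: D_def)
  ultimately have Di: "integrable P D" and
    De: "(\<integral>t. D t \<partial>P) = enn2real (\<integral>\<^sup>+ t. KL_integrand (xs t) (X 0 t) \<partial>P)"
    using KL_start by (auto intro!: integrableI_nonneg simp: integral_eq_nn_integral)
  have Xi: "integrable P (X k)" "(\<integral>t. X k t \<partial>P) = 1" for k
    using X_density[of k] by (auto simp: prob_density_def)
  have "(\<Sum>k<n. gain k) = (\<integral>t. (\<Sum>k<n. xs t * ln (factor k t)) \<partial>P)"
    unfolding gain_def using xs_ln_factor_integrable by simp
  also have "\<dots> \<le> (\<integral>t. D t - X 0 t + X n t \<partial>P)"
  proof (rule integral_mono_AE)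
    show "AE t in P. (\<Sum>k<n. xs t * ln (factor k t)) \<le> D t - X 0 t + X n t"
      using X_exp[of n] KL_start_AE
    proof eventually_elim
      case (elim t)
      then show ?case
        using KL_integrand_exp_shift[of "xs t" "X 0 t" "log_factor n t"]
        by (simp add: D_def log_factor_def sum_distrib_left)
    qed
  qed (use xs_ln_factor_integrable Di Xi in auto)
  also have "\<dots> = (\<integral>t. D t \<partial>P)" using Di Xi by simp
  finally show ?thesis by (simp add: De)
qed

definition stationary :: "nat \<Rightarrow> bool" where
  "stationary k \<longleftrightarrow> (\<forall>i\<le>N. AE t in P. X (k + i) t = X k t)"

lemma idle_cycle:
  assumes "\<forall>i<N. \<not> active (k + i)" "i \<le> N"
  shows "X (k + i) = X k"
  using assms(2) by (induction i) (use assms(1) idle_unchanged in auto)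

text \<open>The stopping rule is stated through the iterates, the estimates through the active steps. The two
  agree since \<open>x\<^sub>k > 0\<close> almost everywhere on \<open>x\<^sup>* > 0\<close>: there \<open>x\<^sub>0 > 0\<close> because
  \<open>d(x\<^sup>*, x\<^sub>0) < \<infinity>\<close>, and the factors are positive. So an unchanged iterate has factor one there, which
  \<open>active_changes\<close> excludes for active steps.\<close>

lemma stationary_iff: "stationary k \<longleftrightarrow> (\<forall>i<N. \<not> active (k + i))"
proof
  assume st: "stationary k"
  show "\<forall>i<N. \<not> active (k + i)"
  proof safe
    fix i assume i: "i < N" and act: "active (k + i)"
    have "AE t in P. X (k + i) t = X k t" "AE t in P. X (k + Suc i) t = X k t"
      using st i unfolding stationary_def by (auto simp del: add_Suc_right)
    then have "AE t in P. xs t = 0 \<or> factor (k + i) t = 1"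
      using X_Suc[of "k + i"] X_exp[of "k + i"] KL_start_AE
    proof eventually_elim
      case (elim t)
      have eq: "X (k + i) t * factor (k + i) t = X (k + i) t" using elim by simp
      have "xs t = 0 \<or> X 0 t \<noteq> 0"
        using elim(5) by (auto simp: KL_integrand_def split: if_splits)
      then show ?case using eq elim(4) by auto
    qed
    with active_changes[OF act] show False by blast
  qed
next
  assume "\<forall>i<N. \<not> active (k + i)"
  then show "stationary k" unfolding stationary_def using idle_cycle by auto
qed

text \<open>Every cycle before stopping contains an active step, hence contributes at least
  \<open>(\<tau> - 1) \<gamma> d\<close> to a sum of gains that is bounded by \<open>energy\<close>.\<close>

lemma cycles_bound:
  assumes ns: "\<And>q. q < n \<Longrightarrow> \<not> stationary (q * N)"
    and d: "\<And>j. j < N \<Longrightarrow> d \<le> \<delta> j"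
  shows "real n * ((\<tau> - 1) * \<gamma> * d) \<le> enn2real (\<integral>\<^sup>+ t. KL_integrand (xs t) (X 0 t) \<partial>P)"
proof -
  have g0: "0 \<le> gain k" for k
    using gain_active[of k] gain_idle[of k] \<tau> \<gamma>_nonneg \<delta>[of "k mod N"]
    by (cases "active k") (auto intro: order_trans[rotated])
  have "(\<tau> - 1) * \<gamma> * d \<le> (\<Sum>k = q * N..<q * N + N. gain k)" if q: "q < n" for q
  proof -
    obtain i where i: "i < N" "active (q * N + i)"
      using ns[OF q] by (auto simp: stationary_iff)
    have "(\<tau> - 1) * \<gamma> * d \<le> (\<tau> - 1) * \<gamma> * \<delta> ((q * N + i) mod N)"
      using d[of "(q * N + i) mod N"] \<tau> \<gamma>_nonneg by (intro mult_left_mono) auto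
    also have "\<dots> \<le> gain (q * N + i)" by (rule gain_active[OF i(2)])
    also have "\<dots> \<le> (\<Sum>k = q * N..<q * N + N. gain k)"
      by (rule member_le_sum) (use i g0 in auto)
    finally show ?thesis .
  qed
  then have "(\<Sum>q<n. (\<tau> - 1) * \<gamma> * d) \<le> (\<Sum>q<n. \<Sum>k = q * N..<q * N + N. gain k)"
    by (intro sum_mono) auto
  also have "\<dots> = (\<Sum>k<n * N. gain k)" by (rule sum.nat_group)
  also have "\<dots> \<le> enn2real (\<integral>\<^sup>+ t. KL_integrand (xs t) (X 0 t) \<partial>P)" by (rule energy)
  finally show ?thesis by simp
qed

lemma always_stationary: "\<gamma> = 0 \<Longrightarrow> stationary k"
  using active_\<gamma>_pos by (auto simp: stationary_iff)

lemma ex_stationary: "\<exists>q. stationary (q * N)"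
proof (rule ccontr)
  assume no: "\<not> (\<exists>q. stationary (q * N))"
  then have \<gamma>p: "0 < \<gamma>" using always_stationary \<gamma>_nonneg by (metis less_eq_real_def)
  define d where "d = Min (\<delta> ` {..<N})"
  have d: "0 < d" "\<And>j. j < N \<Longrightarrow> d \<le> \<delta> j"
    unfolding d_def using N \<delta> by (subst Min_gr_iff) (auto simp: lessThan_empty_iff)
  have c: "0 < (\<tau> - 1) * \<gamma> * d" using \<gamma>p \<tau> d by simp
  obtain n :: nat where "enn2real (\<integral>\<^sup>+ t. KL_integrand (xs t) (X 0 t) \<partial>P) < real n * ((\<tau> - 1) * \<gamma> * d)"
    using reals_Archimedean3[OF c] by blast
  with cycles_bound[of n d] no d(2) show False by force
qed

lemma stationary_residual:
  assumes st: "stationary (q * N)" and j: "j < N"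
  shows "KL j (q * N) \<le> ennreal (\<tau> * \<gamma> * \<delta> j)"
proof -
  have na: "\<forall>i<N. \<not> active (q * N + i)" using st stationary_iff by blast
  then have "X (q * N + j) = X (q * N)" using idle_cycle j by auto
  moreover have "\<not> active (q * N + j)" using na j by blast
  ultimately show ?thesis using j by (auto simp: active_def KL_def)
qed

end

text \<open>The \<open>L\<^sup>1\<close> norm is estimated by \<open>\<bar>w\<bar> \<le> e + w\<^sup>2 / e\<close> and \<open>KL_ge_square\<close>. The free parameter
  \<open>e\<close> takes the place of the square root in Pinsker's inequality.\<close>

lemma (in loping_run) residual_integral_bound:
  assumes j: "j < N" and res: "KL j k \<le> ennreal (\<tau> * \<gamma> * \<delta> j)" and e: "0 < e"
  shows "(\<integral>s. \<bar>kernel_integral P (G j) (X k) s - y j s\<bar> \<partial>Q)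
    \<le> e * measure Q (space Q) + 4 * max M1 M * (\<tau> * \<gamma> * \<delta> j) / e + \<delta> j"
proof -
  interpret K: kernel_pair P Q "G j" m M by (rule kernel[OF j])
  note X_measurable [measurable]
  have [measurable]: "yd j \<in> borel_measurable Q" "y j \<in> borel_measurable Q"
    using yd_measurable[OF j] y[OF j] by auto
  let ?u = "kernel_integral P (G j) (X k)"
  let ?kl = "\<lambda>s. yd j s * ln (yd j s / ?u s) - yd j s + ?u s"
  define C where "C = max M1 M"
  have C0: "0 < C" using K.M_pos by (simp add: C_def)
  have th0: "0 \<le> \<tau> * \<gamma> * \<delta> j" using \<tau> \<gamma>_nonneg \<delta>[OF j] by simp
  note KL = K.step_KL[OF X_density[of k] m1 yd[OF j] yd_bounds[OF j]]
  have "(\<integral>s. ?kl s \<partial>Q) \<le> \<tau> * \<gamma> * \<delta> j"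
    using res th0 unfolding KL_eq[OF j] KL(4) by simp
  then have kl: "4 * C / e * (\<integral>s. ?kl s \<partial>Q) \<le> 4 * C / e * (\<tau> * \<gamma> * \<delta> j)"
    using C0 e by (intro mult_left_mono) auto
  have iu: "integrable Q ?u"
  proof (rule K.integrable_bounded_Q)
    show "AE s in Q. \<bar>?u s\<bar> \<le> M"
      using K.prob_density_T_bounds[OF X_density[of k]] K.m_pos by (intro AE_I2) force
  qed measurable
  have iy: "integrable Q (yd j)" "integrable Q (y j)"
    using yd[OF j] y[OF j] by (auto simp: prob_density_def)
  have "(\<integral>s. \<bar>?u s - y j s\<bar> \<partial>Q) \<le> (\<integral>s. (e + 4 * C / e * ?kl s) + \<bar>y j s - yd j s\<bar> \<partial>Q)"
  proof (rule integral_mono_AE)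
    show "integrable Q (\<lambda>s. (e + 4 * C / e * ?kl s) + \<bar>y j s - yd j s\<bar>)"
      by (intro Bochner_Integration.integrable_add[OF Bochner_Integration.integrable_add[OF _
            integrable_mult_right[OF KL(5)]]]) (use iy in auto)
    show "AE s in Q. \<bar>?u s - y j s\<bar> \<le> (e + 4 * C / e * ?kl s) + \<bar>y j s - yd j s\<bar>"
      using yd_bounds[OF j] AE_space
    proof eventually_elim
      case (elim s)
      note u = K.prob_density_T_bounds[OF X_density[of k] elim(2)]
      define w where "w = yd j s - ?u s"
      have sq: "w\<^sup>2 \<le> 4 * C * ?kl s"
        unfolding w_def by (rule KL_ge_square) (use elim u m1 K.m_pos in \<open>auto simp: C_def\<close>)
      have "\<bar>w\<bar> * e \<le> e * e + w\<^sup>2"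
      proof (cases "\<bar>w\<bar> \<le> e")
        case True
        then have "\<bar>w\<bar> * e \<le> e * e" using e by (intro mult_right_mono) auto
        then show ?thesis by (simp add: add_increasing2)
      next
        case False
        then have "\<bar>w\<bar> * e \<le> \<bar>w\<bar> * \<bar>w\<bar>" by (intro mult_left_mono) auto
        then show ?thesis using e by (simp add: power2_eq_square add_increasing)
      qed
      also have "\<dots> \<le> e * e + 4 * C * ?kl s" using sq by simp
      finally have "\<bar>w\<bar> \<le> e + 4 * C / e * ?kl s" using e by (simp add: field_simps)
      then show ?case unfolding w_def by linarith
    qed
  qed (use iu iy in auto)
  also have "\<dots> = e * measure Q (space Q) + 4 * C / e * (\<integral>s. ?kl s \<partial>Q) + (\<integral>s. \<bar>y j s - yd j s\<bar> \<partial>Q)"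
  proof -
    have "integrable Q (\<lambda>s. 4 * C / e * ?kl s)" using KL(5) by (rule integrable_mult_right)
    then show ?thesis using iy by simp
  qed
  also have "\<dots> \<le> e * measure Q (space Q) + 4 * C * (\<tau> * \<gamma> * \<delta> j) / e + \<delta> j"
    using kl noise[OF j] by simp
  finally show ?thesis unfolding C_def .
qed

section \<open>Weak compactness of nonnegative sequences bounded in Lp\<close>

text \<open>Used for the countable unions in the Dynkin argument, where finite partial sums approximate uniformly.\<close>

lemma convergent_uniform_approx:
  fixes u :: "nat \<Rightarrow> real"
  assumes "\<And>e. 0 < e \<Longrightarrow> \<exists>v. convergent v \<and> (\<forall>l. \<bar>u l - v l\<bar> \<le> e)"
  shows "convergent u"
  unfolding Cauchy_convergent_iff[symmetric]
proof (rule metric_CauchyI)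
  fix e :: real assume e: "0 < e"
  obtain v where v: "convergent v" "\<And>l. \<bar>u l - v l\<bar> \<le> e / 4"
    using assms[of "e / 4"] e by auto
  obtain K where K: "\<And>i j. K \<le> i \<Longrightarrow> K \<le> j \<Longrightarrow> dist (v i) (v j) < e / 4"
    using metric_CauchyD[of v "e / 4"] v(1) e by (auto simp: Cauchy_convergent_iff)
  have "dist (u i) (u j) < e" if "K \<le> i" "K \<le> j" for i j
    using K[OF that] v(2)[of i] v(2)[of j] e unfolding dist_real_def by arith
  then show "\<exists>K. \<forall>i\<ge>K. \<forall>j\<ge>K. dist (u i) (u j) < e" by blast
qed

text \<open>The set family \<open>\<G>\<close> generates the measurable sets up to null sets, which is what a countable
  family can achieve for the Lebesgue sets. The functions are nonnegative, so that the set-wise limits form a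
  measure.\<close>

locale uniformly_integrable_seq = finite_measure P for P :: "'a measure" +
  fixes f :: "nat \<Rightarrow> 'a \<Rightarrow> real" and \<G> :: "'a set set"
  assumes f_int: "\<And>l. integrable P (f l)" and f_nonneg: "\<And>l t. 0 \<le> f l t"
    and equi: "\<And>e. 0 < e \<Longrightarrow> \<exists>d>0. \<forall>l. \<forall>E\<in>sets P. measure P E < d \<longrightarrow> (\<integral>t. f l t * indicator E t \<partial>P) \<le> e"
    and gen_sets: "\<G> \<subseteq> sets P" and gen_space: "space P \<in> \<G>" and gen_Int: "Int_stable \<G>"
    and gen: "\<And>E. E \<in> sets P \<Longrightarrow> \<exists>F\<in>sigma_sets (space P) \<G>. AE t in P. t \<in> E \<longleftrightarrow> t \<in> F"
    and conv_gen: "\<And>E. E \<in> \<G> \<Longrightarrow> convergent (\<lambda>l. \<integral>t. f l t * indicator E t \<partial>P)"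
begin

definition I :: "nat \<Rightarrow> 'a set \<Rightarrow> real" where
  "I l E = (\<integral>t. f l t * indicator E t \<partial>P)"

lemma f_meas [measurable]: "f l \<in> borel_measurable P"
  using f_int by auto

lemma int_ind: "E \<in> sets P \<Longrightarrow> integrable P (\<lambda>t. f l t * indicator E t)"
  using integrable_mult_indicator[OF _ f_int, of E l] by (simp add: mult.commute)

lemma I_nonneg: "0 \<le> I l E"
  unfolding I_def by (simp add: f_nonneg)

lemma I_Un:
  assumes "E \<in> sets P" "F \<in> sets P" "E \<inter> F = {}"
  shows "I l (E \<union> F) = I l E + I l F"
proof -
  have "I l (E \<union> F) = (\<integral>t. f l t * indicator E t + f l t * indicator F t \<partial>P)"
    unfolding I_def using assms(3)
    by (intro Bochner_Integration.integral_cong) (auto simp: indicator_def)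
  also have "\<dots> = I l E + I l F"
    unfolding I_def using int_ind assms by simp
  finally show ?thesis .
qed

lemma I_Diff:
  assumes "E \<in> sets P" "F \<in> sets P" "F \<subseteq> E"
  shows "I l (E - F) = I l E - I l F"
proof -
  have "E - F \<union> F = E" "(E - F) \<inter> F = {}" using assms by auto
  then show ?thesis using I_Un[of "E - F" F l] assms by simp
qed

lemma I_UN:
  fixes A :: "nat \<Rightarrow> 'a set"
  assumes "disjoint_family A" "range A \<subseteq> sets P"
  shows "I l (\<Union>i<n. A i) = (\<Sum>i<n. I l (A i))"
proof (induction n)
  case 0
  then show ?case by (simp add: I_def)
next
  case (Suc n)
  have sets: "A i \<in> sets P" for i using assms(2) by auto
  have disj: "(\<Union>i<n. A i) \<inter> A n = {}"
    using disjoint_family_onD[OF assms(1), of _ n] by fastforce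
  have "I l ((\<Union>i<n. A i) \<union> A n) = I l (\<Union>i<n. A i) + I l (A n)"
    by (rule I_Un[OF _ sets disj]) (intro sets.finite_UN, simp_all add: sets)
  then show ?case using Suc by (simp add: lessThan_Suc Un_commute)
qed

text \<open>Uniform integrability makes the tails of a disjoint union small uniformly in \<open>l\<close>; this allows the
  limit in \<open>l\<close> to be interchanged with countable unions.\<close>

lemma small_tail:
  fixes A :: "nat \<Rightarrow> 'a set"
  assumes A: "disjoint_family A" "range A \<subseteq> sets P" and e: "0 < e"
  shows "\<exists>n0. \<forall>n\<ge>n0. \<forall>l. \<bar>I l (\<Union>i. A i) - (\<Sum>i<n. I l (A i))\<bar> \<le> e"
proof -
  obtain d where d: "0 < d" "\<And>l E. E \<in> sets P \<Longrightarrow> measure P E < d \<Longrightarrow> I l E \<le> e"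
    using equi[OF e] unfolding I_def by blast
  let ?U = "\<lambda>n. \<Union>i<n. A i"
  have U: "?U n \<in> sets P" "(\<Union>i. A i) \<in> sets P" for n using A by auto
  have "(\<lambda>n. measure P (?U n)) \<longlonglongrightarrow> measure P (\<Union>n. ?U n)"
    by (rule finite_Lim_measure_incseq) (use U in \<open>auto simp: incseq_def intro: less_le_trans\<close>)
  moreover have "(\<Union>n. ?U n) = (\<Union>i. A i)" by auto
  ultimately have "\<forall>\<^sub>F n in sequentially. dist (measure P (?U n)) (measure P (\<Union>i. A i)) < d"
    using d(1) tendstoD by fastforce
  then obtain n0 where n0: "\<And>n. n0 \<le> n \<Longrightarrow> dist (measure P (?U n)) (measure P (\<Union>i. A i)) < d"
    by (auto simp: eventually_sequentially)
  have "\<bar>I l (\<Union>i. A i) - (\<Sum>i<n. I l (A i))\<bar> \<le> e" if "n0 \<le> n" for n l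
  proof -
    have "measure P ((\<Union>i. A i) - ?U n) = measure P (\<Union>i. A i) - measure P (?U n)"
      by (rule finite_measure_Diff) (use U in auto)
    then have "measure P ((\<Union>i. A i) - ?U n) < d"
      using n0[OF that] by (simp add: dist_real_def)
    then have "I l ((\<Union>i. A i) - ?U n) \<le> e" by (intro d(2)) (use U in auto)
    moreover have "I l ((\<Union>i. A i) - ?U n) = I l (\<Union>i. A i) - (\<Sum>i<n. I l (A i))"
      by (subst I_Diff) (use U I_UN[OF A] in auto)
    ultimately show ?thesis using I_nonneg[of l "(\<Union>i. A i) - ?U n"] by simp
  qed
  then show ?thesis by blast
qed

lemma sigma_gen_sets: "sigma_sets (space P) \<G> \<subseteq> sets P"
  using gen_sets by (rule sets.sigma_sets_subset)

text \<open>The sets whose integrals converge form a Dynkin system.\<close>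

lemma conv_sigma:
  assumes "E \<in> sigma_sets (space P) \<G>"
  shows "convergent (\<lambda>l. I l E)"
proof -
  have "\<G> \<subseteq> Pow (space P)" using gen_sets sets.sets_into_space by auto
  from gen_Int this assms show ?thesis
  proof (induction rule: sigma_sets_induct_disjoint)
    case (basic A)
    then show ?case using conv_gen by (simp add: I_def)
  next
    case empty
    then show ?case by (simp add: I_def convergent_const)
  next
    case (compl A)
    have "I l (space P - A) = I l (space P) - I l A" for l
      using I_Diff[of "space P" A l] compl sigma_gen_sets sets.sets_into_space by auto
    moreover have "convergent (\<lambda>l. I l (space P))" using conv_gen[OF gen_space] by (simp add: I_def)
    ultimately show ?case using compl(2) by (simp add: convergent_diff)
  next
    case (union A)
    have A: "range A \<subseteq> sets P" using union sigma_gen_sets by auto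
    show ?case
    proof (rule convergent_uniform_approx)
      fix e :: real assume "0 < e"
      then obtain n where "\<forall>l. \<bar>I l (\<Union>i. A i) - (\<Sum>i<n. I l (A i))\<bar> \<le> e"
        using small_tail[OF union(1) A] by blast
      moreover have "convergent (\<lambda>l. \<Sum>i<n. I l (A i))"
        using union by (intro convergent_sum) auto
      ultimately show "\<exists>v. convergent v \<and> (\<forall>l. \<bar>I l (\<Union>i. A i) - v l\<bar> \<le> e)" by blast
    qed
  qed
qed

lemma conv_sets:
  assumes E: "E \<in> sets P"
  shows "convergent (\<lambda>l. I l E)"
proof -
  obtain F where F: "F \<in> sigma_sets (space P) \<G>" "AE t in P. t \<in> E \<longleftrightarrow> t \<in> F"
    using gen[OF E] by blast
  have [measurable]: "F \<in> sets P" using F sigma_gen_sets by blast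
  note E[measurable]
  have "I l E = I l F" for l
    unfolding I_def by (rule integral_cong_AE) (use F(2) in \<open>auto elim!: eventually_mono simp: indicator_def\<close>)
  then show ?thesis using conv_sigma[OF F(1)] by simp
qed

definition \<nu> :: "'a set \<Rightarrow> real" where "\<nu> E = lim (\<lambda>l. I l E)"

lemma \<nu>_lim: "E \<in> sets P \<Longrightarrow> (\<lambda>l. I l E) \<longlonglongrightarrow> \<nu> E"
  unfolding \<nu>_def using conv_sets convergent_LIMSEQ_iff by blast

lemma \<nu>_nonneg: "E \<in> sets P \<Longrightarrow> 0 \<le> \<nu> E"
  by (rule LIMSEQ_le_const[OF \<nu>_lim]) (auto simp: I_nonneg)

lemma \<nu>_sums:
  fixes A :: "nat \<Rightarrow> 'a set"
  assumes A: "disjoint_family A" "range A \<subseteq> sets P"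
  shows "(\<lambda>i. \<nu> (A i)) sums \<nu> (\<Union>i. A i)"
  unfolding sums_def
proof (rule LIMSEQ_I)
  fix e :: real assume e: "0 < e"
  obtain n0 where n0: "\<And>n l. n0 \<le> n \<Longrightarrow> \<bar>I l (\<Union>i. A i) - (\<Sum>i<n. I l (A i))\<bar> \<le> e / 2"
    using small_tail[OF A, of "e / 2"] e by auto
  have "norm ((\<Sum>i<n. \<nu> (A i)) - \<nu> (\<Union>i. A i)) < e" if "n0 \<le> n" for n
  proof -
    have U: "(\<Union>i. A i) \<in> sets P" "\<And>i. A i \<in> sets P" using A by auto
    have "(\<lambda>l. \<bar>I l (\<Union>i. A i) - (\<Sum>i<n. I l (A i))\<bar>) \<longlonglongrightarrow> \<bar>\<nu> (\<Union>i. A i) - (\<Sum>i<n. \<nu> (A i))\<bar>"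
      by (intro tendsto_intros \<nu>_lim U)
    then have "\<bar>\<nu> (\<Union>i. A i) - (\<Sum>i<n. \<nu> (A i))\<bar> \<le> e / 2"
      by (rule LIMSEQ_le_const2) (use n0[OF that] in auto)
    then show ?thesis using e by (simp add: abs_minus_commute)
  qed
  then show "\<exists>n0. \<forall>n\<ge>n0. norm ((\<Sum>i<n. \<nu> (A i)) - \<nu> (\<Union>i. A i)) < e" by blast
qed

text \<open>The set-wise limit is a measure that is absolutely continuous with respect to \<open>P\<close> (a special
  case of the Vitali--Hahn--Saks theorem); its Radon--Nikodym density is \<open>z\<close>.\<close>

theorem limit_density:
  "\<exists>z. integrable P z \<and> (\<forall>t. 0 \<le> z t) \<and>
    (\<forall>E\<in>sets P. (\<lambda>l. \<integral>t. f l t * indicator E t \<partial>P) \<longlonglongrightarrow> (\<integral>t. z t * indicator E t \<partial>P))"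
proof -
  define V where "V = measure_of (space P) (sets P) (\<lambda>E. ennreal (\<nu> E))"
  have sV: "sets V = sets P" "space V = space P" by (auto simp: V_def)
  have V: "emeasure V E = ennreal (\<nu> E)" if "E \<in> sets P" for E
  proof (rule emeasure_measure_of[OF V_def])
    show "sets P \<subseteq> Pow (space P)" using sets.sets_into_space by auto
    show "E \<in> sets V" using that by (simp add: sV)
    have "\<nu> {} = 0" by (simp add: \<nu>_def I_def)
    then show "positive (sets V) (\<lambda>E. ennreal (\<nu> E))" by (simp add: positive_def)
    show "countably_additive (sets V) (\<lambda>E. ennreal (\<nu> E))"
      unfolding countably_additive_def sV
    proof safe
      fix A :: "nat \<Rightarrow> 'a set" assume A: "range A \<subseteq> sets P" "disjoint_family A"
      show "(\<Sum>i. ennreal (\<nu> (A i))) = ennreal (\<nu> (\<Union>i. A i))"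
        by (rule suminf_ennreal_eq[OF _ \<nu>_sums]) (use A \<nu>_nonneg in auto)
    qed
  qed
  have "absolutely_continuous P V"
    unfolding absolutely_continuous_def
  proof safe
    fix E assume E: "E \<in> null_sets P"
    then have Es [measurable]: "E \<in> sets P" by auto
    have "AE t in P. t \<notin> E" by (rule AE_not_in[OF E])
    then have "I l E = (\<integral>t. 0 \<partial>P)" for l
      unfolding I_def by (intro integral_cong_AE) (auto elim!: eventually_mono)
    then have "\<nu> E = 0" by (simp add: \<nu>_def)
    then show "E \<in> null_sets V" using Es by (simp add: null_sets_def V sV)
  qed
  from Radon_Nikodym[OF this sV(1)] obtain g where g [measurable]: "g \<in> borel_measurable P" "density P g = V"
    by auto
  have tot: "(\<integral>\<^sup>+ t. g t \<partial>P) = ennreal (\<nu> (space P))"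
  proof -
    have "ennreal (\<nu> (space P)) = emeasure (density P g) (space P)" using V[of "space P"] g(2) by simp
    also have "\<dots> = (\<integral>\<^sup>+ t. g t * indicator (space P) t \<partial>P)" by (rule emeasure_density) auto
    also have "\<dots> = (\<integral>\<^sup>+ t. g t \<partial>P)" by (rule nn_integral_cong) simp
    finally show ?thesis by simp
  qed
  have fin: "AE t in P. g t \<noteq> \<infinity>"
    by (rule nn_integral_PInf_AE) (use tot in auto)
  define z where "z t = enn2real (g t)" for t
  have gz: "AE t in P. g t = ennreal (z t)"
    using fin by eventually_elim (simp add: z_def less_top)
  have zm [measurable]: "z \<in> borel_measurable P" unfolding z_def by measurable
  have z0: "0 \<le> z t" for t by (simp add: z_def)
  have "(\<integral>\<^sup>+ t. ennreal (z t) \<partial>P) = ennreal (\<nu> (space P))"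
    unfolding tot[symmetric] by (rule nn_integral_cong_AE) (use gz in auto)
  then have zi: "integrable P z" by (intro integrableI_nonneg) (auto simp: z0)
  have "(\<integral>t. z t * indicator E t \<partial>P) = \<nu> E" if E [measurable]: "E \<in> sets P" for E
  proof -
    have "ennreal (\<nu> E) = (\<integral>\<^sup>+ t. g t * indicator E t \<partial>P)"
      using V[OF E] emeasure_density[OF g(1) E] g(2) by simp
    also have "\<dots> = (\<integral>\<^sup>+ t. ennreal (z t * indicator E t) \<partial>P)"
      by (rule nn_integral_cong_AE)
        (use gz in \<open>auto elim!: eventually_mono simp: indicator_def\<close>)
    finally have "enn2real (\<integral>\<^sup>+ t. ennreal (z t * indicator E t) \<partial>P) = \<nu> E"
      using \<nu>_nonneg[OF E] by (metis enn2real_ennreal)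
    then show ?thesis
      by (subst integral_eq_nn_integral) (auto simp: z0)
  qed
  then have "\<forall>E\<in>sets P. (\<lambda>l. \<integral>t. f l t * indicator E t \<partial>P) \<longlonglongrightarrow> (\<integral>t. z t * indicator E t \<partial>P)"
    using \<nu>_lim by (simp add: I_def)
  with zi z0 show ?thesis by blast
qed

end

text \<open>Young's inequality for \<open>c x\<close> and \<open>w / c\<close>. Choosing first \<open>c\<close> small and then \<open>w\<close> small in
  \<open>L\<^sup>q\<close> replaces Hoelder's inequality in what follows.\<close>

lemma Young_scaled:
  fixes p q c x w :: real
  assumes p: "1 < p" and q: "q = p / (p - 1)" and c: "0 < c" and x: "0 \<le> x"
  shows "x * \<bar>w\<bar> \<le> c powr p * x powr p + c powr (- q) * \<bar>w\<bar> powr q"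
proof -
  have q1: "1 < q" and pq: "1 / p + 1 / q = 1" using p by (auto simp: q field_simps)
  have "x * \<bar>w\<bar> = (c * x) * (\<bar>w\<bar> / c)" using c by simp
  also have "\<dots> \<le> (c * x) powr p / p + (\<bar>w\<bar> / c) powr q / q"
    by (rule Youngs_inequality[OF p q1 pq]) (use c x in auto)
  also have "\<dots> \<le> (c * x) powr p + (\<bar>w\<bar> / c) powr q"
  proof (rule add_mono)
    show "(c * x) powr p / p \<le> (c * x) powr p"
      using p divide_left_mono[of 1 p "(c * x) powr p"] by simp
    show "(\<bar>w\<bar> / c) powr q / q \<le> (\<bar>w\<bar> / c) powr q"
      using q1 divide_left_mono[of 1 q "(\<bar>w\<bar> / c) powr q"] by simp
  qed
  also have "\<dots> = c powr p * x powr p + c powr (- q) * \<bar>w\<bar> powr q"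
    using c x by (simp add: powr_mult powr_divide powr_minus field_simps)
  finally show ?thesis .
qed

text \<open>Integrated over a small set, with \<open>K\<close> large, this gives uniform integrability of \<open>L\<^sup>p\<close>-bounded
  sequences.\<close>

lemma le_add_powr:
  fixes p K x :: real
  assumes p: "1 < p" and K: "0 < K" and x: "0 \<le> x"
  shows "x \<le> K + K powr (1 - p) * x powr p"
proof (cases "x \<le> K")
  case True
  then show ?thesis by (simp add: add_increasing2)
next
  case False
  then have xp: "0 < x" using K by simp
  have "x = x powr (1 - p) * x powr p" using xp by (simp flip: powr_add)
  also have "\<dots> \<le> K powr (1 - p) * x powr p"
    using False K p by (intro mult_right_mono powr_mono2') auto
  finally show ?thesis using K by simp
qed

lemma integrable_mult_Lp:
  fixes f h :: "'a \<Rightarrow> real"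
  assumes p: "1 < p" and q: "q = p / (p - 1)"
    and [measurable]: "f \<in> borel_measurable P" "h \<in> borel_measurable P"
    and f: "\<And>t. 0 \<le> f t" "integrable P (\<lambda>t. f t powr p)"
    and h: "integrable P (\<lambda>t. \<bar>h t\<bar> powr q)"
  shows "integrable P (\<lambda>t. f t * h t)"
proof (rule Bochner_Integration.integrable_bound)
  show "integrable P (\<lambda>t. f t powr p + \<bar>h t\<bar> powr q)" using f h by simp
  show "AE t in P. norm (f t * h t) \<le> norm (f t powr p + \<bar>h t\<bar> powr q)"
    using Young_scaled[OF p q, of 1 "f _"] f(1) by (intro AE_I2) (simp add: abs_mult)
qed measurable

lemma integral_mult_Lp_le:
  fixes f h :: "'a \<Rightarrow> real"
  assumes p: "1 < p" and q: "q = p / (p - 1)" and c: "0 < c"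
    and fm: "f \<in> borel_measurable P" and hm: "h \<in> borel_measurable P"
    and f: "\<And>t. 0 \<le> f t" "integrable P (\<lambda>t. f t powr p)"
    and h: "integrable P (\<lambda>t. \<bar>h t\<bar> powr q)"
  shows "\<bar>\<integral>t. f t * h t \<partial>P\<bar>
     \<le> c powr p * (\<integral>t. f t powr p \<partial>P) + c powr (- q) * (\<integral>t. \<bar>h t\<bar> powr q \<partial>P)"
proof -
  have "\<bar>\<integral>t. f t * h t \<partial>P\<bar> \<le> (\<integral>t. \<bar>f t * h t\<bar> \<partial>P)"
    by (rule integral_abs_bound)
  also have "\<dots> \<le> (\<integral>t. c powr p * f t powr p + c powr (- q) * \<bar>h t\<bar> powr q \<partial>P)"
  proof (rule integral_mono)
    show "integrable P (\<lambda>t. \<bar>f t * h t\<bar>)"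
      by (intro integrable_abs integrable_mult_Lp[OF p q fm hm f h])
    show "\<bar>f t * h t\<bar> \<le> c powr p * f t powr p + c powr (- q) * \<bar>h t\<bar> powr q" for t
      using Young_scaled[OF p q c f(1), of t "h t"] f(1)[of t] by (simp add: abs_mult)
  qed (use f h in simp)
  also have "\<dots> = c powr p * (\<integral>t. f t powr p \<partial>P) + c powr (- q) * (\<integral>t. \<bar>h t\<bar> powr q \<partial>P)"
    using f h by simp
  finally show ?thesis .
qed

lemma simple_function_tendsto:
  fixes g :: "nat \<Rightarrow> 'a \<Rightarrow> real" and s z :: "'a \<Rightarrow> real"
  assumes s: "simple_function P s"
    and gi: "\<And>l. integrable P (g l)" and zi: "integrable P z"
    and conv: "\<And>E. E \<in> sets P \<Longrightarrow> (\<lambda>l. \<integral>t. g l t * indicator E t \<partial>P) \<longlonglongrightarrow> (\<integral>t. z t * indicator E t \<partial>P)"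
  shows "(\<lambda>l. \<integral>t. g l t * s t \<partial>P) \<longlonglongrightarrow> (\<integral>t. z t * s t \<partial>P)"
proof -
  let ?A = "\<lambda>c. s -` {c} \<inter> space P"
  have fin: "finite (s ` space P)" and A: "\<And>c. ?A c \<in> sets P"
    using s by (auto simp: simple_function_def intro: simple_functionD)
  have rep: "(\<integral>t. k t * s t \<partial>P) = (\<Sum>c\<in>s ` space P. c * (\<integral>t. k t * indicator (?A c) t \<partial>P))"
    if k: "integrable P k" for k :: "'a \<Rightarrow> real"
  proof -
    have "(\<integral>t. k t * s t \<partial>P) = (\<integral>t. (\<Sum>c\<in>s ` space P. c * (k t * indicator (?A c) t)) \<partial>P)"
    proof (rule Bochner_Integration.integral_cong[OF refl])
      fix t assume t: "t \<in> space P"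
      have "(\<Sum>c\<in>s ` space P. c * (k t * indicator (?A c) t))
          = (\<Sum>c\<in>s ` space P. if c = s t then c * k t else 0)"
        by (rule sum.cong) (use t in \<open>auto simp: indicator_def\<close>)
      also have "\<dots> = s t * k t" using fin t by (subst sum.delta) auto
      finally show "k t * s t = (\<Sum>c\<in>s ` space P. c * (k t * indicator (?A c) t))" by simp
    qed
    also have "\<dots> = (\<Sum>c\<in>s ` space P. c * (\<integral>t. k t * indicator (?A c) t \<partial>P))"
    proof -
      have "integrable P (\<lambda>t. k t * indicator (?A c) t)" for c
        using integrable_mult_indicator[OF A k, of c] by (simp add: mult.commute)
      then show ?thesis by simp
    qed
    finally show ?thesis .
  qed
  show ?thesis
    unfolding rep[OF gi] rep[OF zi] by (intro tendsto_sum tendsto_mult tendsto_const conv A)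
qed

text \<open>Simple functions \<open>s\<^sub>i\<close> with \<open>s\<^sub>i \<longrightarrow> h\<close> in \<open>L\<^sup>q\<close> approximate the integrals
  \<open>\<integral> g\<^sub>l h\<close> uniformly in \<open>l\<close>, because the \<open>g\<^sub>l\<close> are bounded in \<open>L\<^sup>p\<close>. The integrability of \<open>z h\<close>
  is an assumption of its own: the lemma is applied to bounded \<open>h\<close> in order to show \<open>z \<in> L\<^sup>p\<close>, and then to
  all \<open>h \<in> L\<^sup>q\<close>.\<close>

lemma weak_test_extend:
  fixes g :: "nat \<Rightarrow> 'a \<Rightarrow> real" and h z :: "'a \<Rightarrow> real"
  assumes p: "1 < p" and q: "q = p / (p - 1)"
    and gi: "\<And>l. integrable P (g l)" and g0: "\<And>l t. 0 \<le> g l t"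
    and gp: "\<And>l. integrable P (\<lambda>t. g l t powr p)" and B: "\<And>l. (\<integral>t. g l t powr p \<partial>P) \<le> B"
    and zi: "integrable P z"
    and conv: "\<And>E. E \<in> sets P \<Longrightarrow> (\<lambda>l. \<integral>t. g l t * indicator E t \<partial>P) \<longlonglongrightarrow> (\<integral>t. z t * indicator E t \<partial>P)"
    and hm [measurable]: "h \<in> borel_measurable P" and hq: "integrable P (\<lambda>t. \<bar>h t\<bar> powr q)"
    and zh: "integrable P (\<lambda>t. z t * h t)"
  shows "(\<lambda>l. \<integral>t. g l t * h t \<partial>P) \<longlonglongrightarrow> (\<integral>t. z t * h t \<partial>P)"
proof -
  have gm [measurable]: "g l \<in> borel_measurable P" for l using gi by auto
  have zm [measurable]: "z \<in> borel_measurable P" using zi by auto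
  have q1: "1 < q" using p by (auto simp: q field_simps)
  have "0 \<le> (\<integral>t. g 0 t powr p \<partial>P)" by simp
  then have B0: "0 \<le> B" using B[of 0] by linarith
  obtain F where F': "\<forall>i. simple_function P (F i)"
    "\<forall>t\<in>space P. (\<lambda>i. F i t) \<longlonglongrightarrow> h t"
    "\<forall>i. \<forall>t\<in>space P. dist (F i t) 0 \<le> 2 * dist (h t) 0"
    using borel_measurable_implies_sequence_metric[OF hm, of 0] by blast
  have F: "\<And>i. simple_function P (F i)"
    "\<And>t. t \<in> space P \<Longrightarrow> (\<lambda>i. F i t) \<longlonglongrightarrow> h t"
    "\<And>i t. t \<in> space P \<Longrightarrow> \<bar>F i t\<bar> \<le> 2 * \<bar>h t\<bar>"
    using F' by auto
  have Fm [measurable]: "F i \<in> borel_measurable P" for i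
    using F(1) by (rule borel_measurable_simple_function)
  have dom: "\<bar>h t - F i t\<bar> powr q \<le> 3 powr q * \<bar>h t\<bar> powr q" if "t \<in> space P" for i t
  proof -
    have "\<bar>h t - F i t\<bar> powr q \<le> (3 * \<bar>h t\<bar>) powr q"
      using F(3)[OF that, of i] q1 by (intro powr_mono2) auto
    then show ?thesis by (simp add: powr_mult)
  qed
  have diff_q: "integrable P (\<lambda>t. \<bar>h t - F i t\<bar> powr q)" for i
  proof (rule Bochner_Integration.integrable_bound)
    show "integrable P (\<lambda>t. 3 powr q * \<bar>h t\<bar> powr q)" using hq by simp
    show "AE t in P. norm (\<bar>h t - F i t\<bar> powr q) \<le> norm (3 powr q * \<bar>h t\<bar> powr q)"
      using dom by (intro AE_I2) simp
  qed measurable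
  have lim1: "(\<lambda>i. \<integral>t. \<bar>h t - F i t\<bar> powr q \<partial>P) \<longlonglongrightarrow> (\<integral>t. 0 \<partial>P)"
  proof (rule integral_dominated_convergence)
    show "integrable P (\<lambda>t. 3 powr q * \<bar>h t\<bar> powr q)" using hq by simp
    show "AE t in P. (\<lambda>i. \<bar>h t - F i t\<bar> powr q) \<longlonglongrightarrow> 0"
    proof (rule AE_I2)
      fix t assume t: "t \<in> space P"
      have "(\<lambda>i. \<bar>h t - F i t\<bar>) \<longlonglongrightarrow> \<bar>h t - h t\<bar>" by (intro tendsto_intros F(2) t)
      then show "(\<lambda>i. \<bar>h t - F i t\<bar> powr q) \<longlonglongrightarrow> 0"
        using q1 by (intro tendsto_zero_powrI[where b = q]) auto
    qed
    show "AE t in P. norm (\<bar>h t - F i t\<bar> powr q) \<le> 3 powr q * \<bar>h t\<bar> powr q" for i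
      using dom by (intro AE_I2) simp
  qed measurable
  have lim2: "(\<lambda>i. \<integral>t. z t * F i t \<partial>P) \<longlonglongrightarrow> (\<integral>t. z t * h t \<partial>P)"
  proof (rule integral_dominated_convergence)
    show "integrable P (\<lambda>t. 2 * \<bar>z t * h t\<bar>)" using zh by simp
    show "AE t in P. (\<lambda>i. z t * F i t) \<longlonglongrightarrow> z t * h t"
      by (intro AE_I2 tendsto_intros F(2))
    show "AE t in P. norm (z t * F i t) \<le> 2 * \<bar>z t * h t\<bar>" for i
    proof (rule AE_I2)
      fix t assume t: "t \<in> space P"
      have "\<bar>z t\<bar> * \<bar>F i t\<bar> \<le> \<bar>z t\<bar> * (2 * \<bar>h t\<bar>)" by (intro mult_left_mono F(3) t) simp
      then show "norm (z t * F i t) \<le> 2 * \<bar>z t * h t\<bar>" by (simp add: abs_mult)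
    qed
  qed measurable
  show ?thesis
  proof (rule LIMSEQ_I)
    fix e :: real assume e: "0 < e"
    \<comment> \<open>This choice of the scaling in Young's inequality makes \<open>c powr p * B\<close> at most \<open>e / 4\<close>.\<close>
    define c where "c = (e / (4 * (B + 1))) powr (1 / p)"
    have c: "0 < c" using e B0 by (simp add: c_def)
    have "c powr p = e / (4 * (B + 1))" using e B0 p by (simp add: c_def powr_powr)
    then have "c powr p * (B + 1) = e / 4" using B0 by (simp add: field_simps)
    moreover have "c powr p * B \<le> c powr p * (B + 1)" by (intro mult_left_mono) auto
    ultimately have cB: "c powr p * B \<le> e / 4" by simp
    have cq: "0 < c powr (- q)" using c by simp
    have "\<forall>\<^sub>F i in sequentially. (\<integral>t. \<bar>h t - F i t\<bar> powr q \<partial>P) < e / 4 / c powr (- q)"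
      by (rule order_tendstoD(2)[OF lim1]) (use e cq in simp)
    moreover have "\<forall>\<^sub>F i in sequentially. dist (\<integral>t. z t * F i t \<partial>P) (\<integral>t. z t * h t \<partial>P) < e / 4"
      using tendstoD[OF lim2, of "e / 4"] e by simp
    ultimately have "\<forall>\<^sub>F i in sequentially. (\<integral>t. \<bar>h t - F i t\<bar> powr q \<partial>P) < e / 4 / c powr (- q)
        \<and> dist (\<integral>t. z t * F i t \<partial>P) (\<integral>t. z t * h t \<partial>P) < e / 4"
      by (rule eventually_conj)
    then obtain i where i: "(\<integral>t. \<bar>h t - F i t\<bar> powr q \<partial>P) < e / 4 / c powr (- q)"
        "dist (\<integral>t. z t * F i t \<partial>P) (\<integral>t. z t * h t \<partial>P) < e / 4"
      by (auto simp: eventually_sequentially)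
    have e1: "c powr (- q) * (\<integral>t. \<bar>h t - F i t\<bar> powr q \<partial>P) < e / 4"
      using i(1) cq by (simp add: field_simps)
    have e2: "\<bar>\<integral>t. g l t * (h t - F i t) \<partial>P\<bar>
        \<le> c powr p * (\<integral>t. g l t powr p \<partial>P) + c powr (- q) * (\<integral>t. \<bar>h t - F i t\<bar> powr q \<partial>P)" for l
      by (rule integral_mult_Lp_le[OF p q c]) (use g0 gp diff_q in auto)
    have e3: "c powr p * (\<integral>t. g l t powr p \<partial>P) \<le> c powr p * B" for l
      by (intro mult_left_mono B) simp
    have est: "\<bar>\<integral>t. g l t * (h t - F i t) \<partial>P\<bar> < e / 2" for l
      using e1 e2[of l] e3[of l] cB by linarith
    have split: "(\<integral>t. g l t * (h t - F i t) \<partial>P) = (\<integral>t. g l t * h t \<partial>P) - (\<integral>t. g l t * F i t \<partial>P)" for l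
    proof -
      have a: "integrable P (\<lambda>t. g l t * h t)"
        by (rule integrable_mult_Lp[OF p q gm hm g0 gp hq])
      have b: "integrable P (\<lambda>t. g l t * (h t - F i t))"
        by (rule integrable_mult_Lp[OF p q gm _ g0 gp diff_q]) measurable
      have "integrable P (\<lambda>t. g l t * h t - g l t * (h t - F i t))"
        using a b by (rule Bochner_Integration.integrable_diff)
      then have c: "integrable P (\<lambda>t. g l t * F i t)" by (simp add: algebra_simps)
      show ?thesis using a c by (simp add: right_diff_distrib)
    qed
    have "(\<lambda>l. \<integral>t. g l t * F i t \<partial>P) \<longlonglongrightarrow> (\<integral>t. z t * F i t \<partial>P)"
      by (rule simple_function_tendsto[OF F(1) gi zi conv])
    then have "\<forall>\<^sub>F l in sequentially. dist (\<integral>t. g l t * F i t \<partial>P) (\<integral>t. z t * F i t \<partial>P) < e / 4"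
      using e by (intro tendstoD) auto
    then obtain l0 where l0: "\<And>l. l0 \<le> l \<Longrightarrow> dist (\<integral>t. g l t * F i t \<partial>P) (\<integral>t. z t * F i t \<partial>P) < e / 4"
      by (auto simp: eventually_sequentially)
    have "norm ((\<integral>t. g l t * h t \<partial>P) - (\<integral>t. z t * h t \<partial>P)) < e" if "l0 \<le> l" for l
      using est[of l] split[of l] l0[OF that] i(2) unfolding dist_real_def real_norm_def by linarith
    then show "\<exists>l0. \<forall>l\<ge>l0. norm ((\<integral>t. g l t * h t \<partial>P) - (\<integral>t. z t * h t \<partial>P)) < e" by blast
  qed
qed

text \<open>Lower semicontinuity of the norm. For the truncations \<open>c\<^sub>n = min z n\<close>, the function
  \<open>c\<^sub>n powr (p - 1)\<close> is a bounded test function; passing to the limit in Young's inequality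
  \<open>g c\<^sup>p\<^sup>-\<^sup>1 \<le> g\<^sup>p / p + c\<^sup>p / q\<close> and using \<open>c\<^sup>p \<le> z c\<^sup>p\<^sup>-\<^sup>1\<close> gives \<open>\<integral> c\<^sub>n\<^sup>p \<le> B\<close> for all \<open>n\<close>.\<close>

lemma (in finite_measure) weak_limit_Lp:
  fixes g :: "nat \<Rightarrow> 'a \<Rightarrow> real" and z :: "'a \<Rightarrow> real"
  assumes p: "1 < p"
    and gi: "\<And>l. integrable M (g l)" and g0: "\<And>l t. 0 \<le> g l t"
    and gp: "\<And>l. integrable M (\<lambda>t. g l t powr p)" and B: "\<And>l. (\<integral>t. g l t powr p \<partial>M) \<le> B"
    and zi: "integrable M z" and z0: "\<And>t. 0 \<le> z t"
    and conv: "\<And>E. E \<in> sets M \<Longrightarrow> (\<lambda>l. \<integral>t. g l t * indicator E t \<partial>M) \<longlonglongrightarrow> (\<integral>t. z t * indicator E t \<partial>M)"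
  shows "integrable M (\<lambda>t. z t powr p)"
proof -
  define q where "q = p / (p - 1)"
  have pq: "(p - 1) * q = p" "1 < q" "1 / p + 1 / q = 1" using p by (auto simp: q_def field_simps)
  have zm [measurable]: "z \<in> borel_measurable M" using zi by auto
  have gm [measurable]: "g l \<in> borel_measurable M" for l using gi by auto
  define c where "c n t = min (z t) (real n)" for n :: nat and t
  have c0: "0 \<le> c n t" "c n t \<le> real n" "c n t \<le> z t" for n t using z0 by (auto simp: c_def)
  have cm [measurable]: "c n \<in> borel_measurable M" for n unfolding c_def by measurable
  have bnd: "integrable M (\<lambda>t. c n t powr r)" if "0 \<le> r" for n r
  proof (rule integrable_const_bound[of _ "real n powr r"])
    show "AE t in M. norm (c n t powr r) \<le> real n powr r"
      using c0 that by (intro AE_I2) (auto intro: powr_mono2)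
  qed measurable
  have zc: "integrable M (\<lambda>t. z t * c n t powr (p - 1))" for n
  proof (rule Bochner_Integration.integrable_bound)
    show "integrable M (\<lambda>t. real n powr (p - 1) * z t)" using zi by simp
    show "AE t in M. norm (z t * c n t powr (p - 1)) \<le> norm (real n powr (p - 1) * z t)"
    proof (rule AE_I2)
      fix t
      have "c n t powr (p - 1) \<le> real n powr (p - 1)" using c0 p by (intro powr_mono2) auto
      then have "z t * c n t powr (p - 1) \<le> z t * real n powr (p - 1)" using z0 by (intro mult_left_mono) auto
      then show "norm (z t * c n t powr (p - 1)) \<le> norm (real n powr (p - 1) * z t)"
        using z0[of t] by (simp add: abs_mult mult.commute)
    qed
  qed measurable
  have cq: "(c n t powr (p - 1)) powr q = c n t powr p" for n t by (simp add: powr_powr pq)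
  have bound: "(\<integral>t. c n t powr p \<partial>M) \<le> B" for n
  proof -
    have lim: "(\<lambda>l. \<integral>t. g l t * c n t powr (p - 1) \<partial>M) \<longlonglongrightarrow> (\<integral>t. z t * c n t powr (p - 1) \<partial>M)"
      by (rule weak_test_extend[OF p q_def gi g0 gp B zi conv])
        (use p bnd zc in \<open>auto simp: cq\<close>)
    have le: "(\<integral>t. g l t * c n t powr (p - 1) \<partial>M) \<le> B / p + (\<integral>t. c n t powr p \<partial>M) / q" for l
    proof -
      have "(\<integral>t. g l t * c n t powr (p - 1) \<partial>M) \<le> (\<integral>t. g l t powr p / p + c n t powr p / q \<partial>M)"
      proof (rule integral_mono)
        show "integrable M (\<lambda>t. g l t * c n t powr (p - 1))"
          by (rule integrable_mult_Lp[OF p q_def gm _ g0 gp]) (use p bnd in \<open>auto simp: cq\<close>)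
        show "integrable M (\<lambda>t. g l t powr p / p + c n t powr p / q)" using gp bnd p by simp
        show "g l t * c n t powr (p - 1) \<le> g l t powr p / p + c n t powr p / q" for t
          using Youngs_inequality[OF p pq(2,3), of "g l t" "c n t powr (p - 1)"] g0 cq[of n t] by simp
      qed
      also have "\<dots> = (\<integral>t. g l t powr p \<partial>M) / p + (\<integral>t. c n t powr p \<partial>M) / q"
        using gp bnd p by simp
      also have "\<dots> \<le> B / p + (\<integral>t. c n t powr p \<partial>M) / q"
        using B[of l] p by (simp add: divide_right_mono)
      finally show ?thesis .
    qed
    have "(\<integral>t. c n t powr p \<partial>M) \<le> (\<integral>t. z t * c n t powr (p - 1) \<partial>M)"
    proof (rule integral_mono)
      show "c n t powr p \<le> z t * c n t powr (p - 1)" for t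
      proof (cases "c n t = 0")
        case False
        then have "c n t powr p = c n t * c n t powr (p - 1)"
          using c0[of n t] powr_mult_base[of "c n t" "p - 1"] by simp
        also have "\<dots> \<le> z t * c n t powr (p - 1)" using c0 by (intro mult_right_mono) auto
        finally show ?thesis .
      qed (use p in simp)
    qed (use zc bnd p in auto)
    also have "\<dots> \<le> B / p + (\<integral>t. c n t powr p \<partial>M) / q"
      by (rule LIMSEQ_le_const2[OF lim]) (use le in auto)
    finally have "(\<integral>t. c n t powr p \<partial>M) * (1 - 1 / q) \<le> B / p" by (simp add: algebra_simps)
    moreover have "1 - 1 / q = 1 / p" using pq by simp
    ultimately show ?thesis using p by (simp add: field_simps)
  qed
  have inc: "incseq (\<lambda>n. \<integral>t. c n t powr p \<partial>M)"
    unfolding incseq_def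
  proof (intro allI impI integral_mono)
    show "c n t powr p \<le> c n' t powr p" if "n \<le> n'" for n n' t
      using that p c0[of n t] by (intro powr_mono2) (auto simp: c_def)
  qed (use bnd p in auto)
  obtain L where L: "(\<lambda>n. \<integral>t. c n t powr p \<partial>M) \<longlonglongrightarrow> L"
    using incseq_convergent[OF inc, of B] bound by blast
  show ?thesis
  proof (rule integrable_monotone_convergence[OF _ _ _ L])
    show "AE t in M. mono (\<lambda>n. c n t powr p)"
      using p c0 by (intro AE_I2 monoI powr_mono2) (auto simp: c_def)
    show "AE t in M. (\<lambda>n. c n t powr p) \<longlonglongrightarrow> z t powr p"
    proof (rule AE_I2)
      fix t
      obtain n0 :: nat where n0: "z t \<le> real n0" using real_arch_simple by blast
      have "\<forall>\<^sub>F n in sequentially. c n t powr p = z t powr p"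
        using eventually_ge_at_top[of n0] by eventually_elim (use n0 in \<open>simp add: c_def\<close>)
      then show "(\<lambda>n. c n t powr p) \<longlonglongrightarrow> z t powr p" by (rule tendsto_eventually)
    qed
  qed (use bnd p in auto)
qed

text \<open>Sequential weak compactness of balls in \<open>L\<^sup>p\<close>, \<open>1 < p < \<infinity>\<close>, restricted to nonnegative functions.
  The countable generator provides the separability needed for the diagonal argument.\<close>

theorem (in finite_measure) nonneg_Lp_weak_compactness:
  fixes f :: "nat \<Rightarrow> 'a \<Rightarrow> real" and \<G> :: "'a set set"
  assumes p: "1 < p"
    and fm: "\<And>l. f l \<in> borel_measurable M" and f0: "\<And>l t. 0 \<le> f l t"
    and fp: "\<And>l. integrable M (\<lambda>t. f l t powr p)" and B: "\<And>l. (\<integral>t. f l t powr p \<partial>M) \<le> B"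
    and \<G>: "countable \<G>" "\<G> \<subseteq> sets M" "space M \<in> \<G>" "Int_stable \<G>"
    and gen: "\<And>E. E \<in> sets M \<Longrightarrow> \<exists>F\<in>sigma_sets (space M) \<G>. AE t in M. t \<in> E \<longleftrightarrow> t \<in> F"
  shows "\<exists>(r :: nat \<Rightarrow> nat) z. strict_mono r \<and> integrable M z \<and> (\<forall>t. 0 \<le> z t) \<and>
    integrable M (\<lambda>t. z t powr p) \<and>
    (\<forall>h\<in>borel_measurable M. integrable M (\<lambda>t. \<bar>h t\<bar> powr (p / (p - 1))) \<longrightarrow>
       (\<lambda>l. \<integral>t. f (r l) t * h t \<partial>M) \<longlonglongrightarrow> (\<integral>t. z t * h t \<partial>M))"
proof -
  note fm [measurable]
  have "0 \<le> (\<integral>t. f 0 t powr p \<partial>M)" by simp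
  then have B0: "0 \<le> B" using B[of 0] by linarith
  have fi: "integrable M (f l)" for l
  proof (rule Bochner_Integration.integrable_bound)
    show "integrable M (\<lambda>t. 1 + f l t powr p)" using fp by simp
    show "AE t in M. norm (f l t) \<le> norm (1 + f l t powr p)"
      using le_add_powr[OF p zero_less_one f0] f0 by (intro AE_I2) simp
  qed measurable
  have est: "(\<integral>t. f l t * indicator E t \<partial>M) \<le> K * measure M E + K powr (1 - p) * B"
    if [measurable]: "E \<in> sets M" and K: "0 < K" for l E K
  proof -
    have "(\<integral>t. f l t * indicator E t \<partial>M) \<le> (\<integral>t. K * indicator E t + K powr (1 - p) * f l t powr p \<partial>M)"
    proof (rule integral_mono)
      show "integrable M (\<lambda>t. f l t * indicator E t)"
        using integrable_mult_indicator[OF that(1) fi[of l]] by (simp add: mult.commute)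
      show "integrable M (\<lambda>t. K * indicator E t + K powr (1 - p) * f l t powr p)"
        using fp that(1) by (intro Bochner_Integration.integrable_add integrable_mult_right) (auto simp: less_top[symmetric])
      show "f l t * indicator E t \<le> K * indicator E t + K powr (1 - p) * f l t powr p" for t
        using le_add_powr[OF p K f0, of l t] by (auto simp: indicator_def)
    qed
    also have "\<dots> = K * measure M E + K powr (1 - p) * (\<integral>t. f l t powr p \<partial>M)"
    proof -
      have "integrable M (\<lambda>t. K * indicator E t)"
        by (intro integrable_mult_right) (auto simp: less_top[symmetric])
      then show ?thesis using fp by (simp add: sets.Int_space_eq2)
    qed
    also have "\<dots> \<le> K * measure M E + K powr (1 - p) * B"
      using B[of l] by (simp add: mult_left_mono)
    finally show ?thesis .
  qed
  have bnd: "norm (\<integral>t. f l t * indicator E t \<partial>M) \<le> measure M (space M) + B" if "E \<in> \<G>" for l E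
  proof -
    have E: "E \<in> sets M" using that \<G> by auto
    have "0 \<le> (\<integral>t. f l t * indicator E t \<partial>M)" by (simp add: f0)
    moreover have "(\<integral>t. f l t * indicator E t \<partial>M) \<le> measure M E + B"
      using est[OF E zero_less_one, of l] by simp
    moreover have "measure M E \<le> measure M (space M)" by (rule bounded_measure)
    ultimately show ?thesis by simp
  qed
  obtain r where r: "strict_mono (r :: nat \<Rightarrow> nat)"
    "\<And>E. E \<in> \<G> \<Longrightarrow> \<exists>L. (\<lambda>l. \<integral>t. f (r l) t * indicator E t \<partial>M) \<longlonglongrightarrow> L"
    using function_convergent_subsequence[of \<G> "\<lambda>l E. \<integral>t. f l t * indicator E t \<partial>M", OF \<G>(1) bnd]
    by blast
  interpret U: uniformly_integrable_seq M "\<lambda>l. f (r l)" \<G>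
  proof unfold_locales
    fix e :: real assume e: "0 < e"
    \<comment> \<open>A large threshold \<open>K\<close> makes the contribution of large values at most \<open>e / 2\<close>.\<close>
    have "((\<lambda>K. K powr (1 - p)) \<longlongrightarrow> 0) at_top"
      using p by (intro tendsto_neg_powr filterlim_ident) auto
    then have "\<forall>\<^sub>F K in at_top. K powr (1 - p) < e / (2 * (B + 1))"
      by (rule order_tendstoD(2)) (use e B0 in simp)
    then have "\<forall>\<^sub>F K in at_top. K powr (1 - p) < e / (2 * (B + 1)) \<and> 0 < K"
      using eventually_gt_at_top[of 0] by eventually_elim simp
    then obtain K where K: "K powr (1 - p) < e / (2 * (B + 1))" "0 < K"
      using eventually_happens'[OF trivial_limit_at_top_linorder] by blast
    have "K powr (1 - p) * B \<le> e / (2 * (B + 1)) * B" using K B0 by (intro mult_right_mono) auto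
    also have "\<dots> \<le> e / 2" using e B0 by (simp add: field_simps)
    finally have KB: "K powr (1 - p) * B \<le> e / 2" .
    have "(\<integral>t. f (r l) t * indicator E t \<partial>M) \<le> e" if E: "E \<in> sets M" "measure M E < e / (2 * K)" for l E
    proof -
      have "K * measure M E \<le> e / 2" using E(2) K(2) by (simp add: field_simps)
      then show ?thesis using est[OF E(1) K(2), of "r l"] KB by simp
    qed
    moreover have "0 < e / (2 * K)" using e K by simp
    ultimately show "\<exists>d>0. \<forall>l. \<forall>E\<in>sets M. measure M E < d \<longrightarrow> (\<integral>t. f (r l) t * indicator E t \<partial>M) \<le> e"
      by blast
  qed (use fi f0 \<G> gen r(2) in \<open>auto simp: convergent_def\<close>)
  obtain z where z: "integrable M z" "\<And>t. 0 \<le> z t"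
    "\<And>E. E \<in> sets M \<Longrightarrow> (\<lambda>l. \<integral>t. f (r l) t * indicator E t \<partial>M) \<longlonglongrightarrow> (\<integral>t. z t * indicator E t \<partial>M)"
    using U.limit_density by blast
  have zp: "integrable M (\<lambda>t. z t powr p)"
    by (rule weak_limit_Lp[OF p, of "\<lambda>l. f (r l)"]) (use fi f0 fp B z in auto)
  show ?thesis
  proof (intro exI[of _ r] exI[of _ z] conjI allI ballI impI r(1) z(1) z(2) zp)
    fix h assume h: "h \<in> borel_measurable M" "integrable M (\<lambda>t. \<bar>h t\<bar> powr (p / (p - 1)))"
    have zm: "z \<in> borel_measurable M" using z by auto
    show "(\<lambda>l. \<integral>t. f (r l) t * h t \<partial>M) \<longlonglongrightarrow> (\<integral>t. z t * h t \<partial>M)"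
      by (rule weak_test_extend[OF p refl, of M "\<lambda>l. f (r l)" B z h])
        (use fi f0 fp B z h integrable_mult_Lp[OF p refl zm h(1) z(2) zp h(2)] in auto)
  qed
qed

section \<open>Lebesgue measure on open sets\<close>

lemma open_in_sets_lebesgue: "open S \<Longrightarrow> S \<in> sets lebesgue"
  by (simp add: borel_open)

text \<open>Completeness of the Lebesgue measure: changing a function on a null set preserves measurability.
  The raw kernels have measurable sections only almost everywhere, so this is needed
  to compare integrals that involve them.\<close>

lemma lebesgue_on_measurable_cong_AE:
  fixes f g :: "'a::euclidean_space \<Rightarrow> real"
  assumes S: "S \<in> sets lebesgue" and f: "f \<in> borel_measurable (lebesgue_on S)"
    and ae: "AE t in lebesgue_on S. f t = g t"
  shows "g \<in> borel_measurable (lebesgue_on S)"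
proof (rule borel_measurable_if_D, rule borel_measurable_AE)
  show "(\<lambda>t. if t \<in> S then f t else 0) \<in> borel_measurable lebesgue"
    by (rule borel_measurable_if_I[OF f S])
  have "AE t in lebesgue. t \<in> S \<longrightarrow> f t = g t"
    using ae S by (simp add: AE_restrict_space_iff)
  then show "AE t in lebesgue. (if t \<in> S then f t else 0) = (if t \<in> S then g t else 0)"
    by eventually_elim auto
qed

lemma LINT_lebesgue_on_cong_AE:
  fixes f g :: "'a::euclidean_space \<Rightarrow> real"
  assumes S: "S \<in> sets lebesgue" and f: "f \<in> borel_measurable (lebesgue_on S)"
    and ae: "AE t in lebesgue_on S. g t = f t"
  shows "(LINT t|lebesgue_on S. g t) = (LINT t|lebesgue_on S. f t)"
proof (rule integral_cong_AE[OF _ f ae])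
  show "g \<in> borel_measurable (lebesgue_on S)"
    by (rule lebesgue_on_measurable_cong_AE[OF S f]) (use ae in \<open>auto elim!: eventually_mono\<close>)
qed

lemma AE_lborel_imp_lebesgue_on:
  assumes "S \<in> sets lebesgue" "AE t in lborel. t \<in> S \<longrightarrow> P t"
  shows "AE t in lebesgue_on S. P t"
  using assms AE_completion[OF assms(2)] by (simp add: AE_restrict_space_iff)

lemma AE_lebesgue_on_imp_lborel:
  assumes "S \<in> sets lebesgue" "AE t in lebesgue_on S. P t"
  shows "AE t in lborel. t \<in> S \<longrightarrow> P t"
  using assms by (simp add: AE_restrict_space_iff AE_completion_iff)

text \<open>The exceptional set is enclosed in a Borel null set, to which Fubini's theorem applies; the predicate
  \<open>P\<close> itself may be nonmeasurable.\<close>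

lemma AE_lborel_pair:
  fixes P :: "'a::euclidean_space \<Rightarrow> 'b::euclidean_space \<Rightarrow> bool"
  assumes "AE p in lborel. P (fst p) (snd p)"
  shows "AE s in lborel. AE t in lborel. P s t" "AE t in lborel. AE s in lborel. P s t"
proof -
  obtain Z where Z: "Z \<in> null_sets (lborel :: ('a \<times> 'b) measure)"
      and Z0: "{p \<in> space lborel. \<not> P (fst p) (snd p)} \<subseteq> Z"
    using assms unfolding eventually_ae_filter by blast
  have Zm: "{p \<in> space (lborel \<Otimes>\<^sub>M lborel). (fst p, snd p) \<notin> Z} \<in> sets (lborel \<Otimes>\<^sub>M lborel)"
  proof -
    have eq: "{p \<in> space (lborel :: ('a \<times> 'b) measure). (fst p, snd p) \<notin> Z} = space lborel - Z" by auto
    show ?thesis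
      unfolding lborel_prod eq by (rule sets.compl_sets[OF null_setsD2[OF Z]])
  qed
  have "AE p in lborel \<Otimes>\<^sub>M lborel. p \<notin> Z"
    unfolding lborel_prod by (rule AE_not_in[OF Z])
  then have *: "AE s in lborel. AE t in lborel. (s, t) \<notin> Z"
    by (rule lborel_pair.AE_pair)
  then have **: "AE t in lborel. AE s in lborel. (s, t) \<notin> Z"
    using lborel_pair.AE_commute[of "\<lambda>s t. (s, t) \<notin> Z"] Zm by blast
  have imp: "(s, t) \<notin> Z \<Longrightarrow> P s t" for s t using Z0 by force
  from * show "AE s in lborel. AE t in lborel. P s t"
    by (rule eventually_mono) (erule eventually_mono, rule imp)
  from ** show "AE t in lborel. AE s in lborel. P s t"
    by (rule eventually_mono) (erule eventually_mono, rule imp)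
qed

text \<open>A Borel version of the kernel on the product space, clipped to \<open>[m, M]\<close>. Clipping changes it only on a
  null set.\<close>

lemma borel_regularisation:
  fixes k :: "'a::euclidean_space \<Rightarrow> 'b::euclidean_space \<Rightarrow> real"
  assumes S: "open S" and T: "open T" and mM: "m \<le> M"
    and k: "(\<lambda>(s, t). k s t) \<in> borel_measurable (lebesgue_on (S \<times> T))"
    and b: "AE (s, t) in lebesgue_on (S \<times> T). m \<le> k s t \<and> k s t \<le> M"
  obtains G where "(\<lambda>(s, t). G s t) \<in> borel_measurable (lebesgue_on S \<Otimes>\<^sub>M lebesgue_on T)"
    "\<And>s t. m \<le> G s t" "\<And>s t. G s t \<le> M"
    "AE s in lebesgue_on S. AE t in lebesgue_on T. k s t = G s t"
    "AE t in lebesgue_on T. AE s in lebesgue_on S. k s t = G s t"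
proof -
  have sets: "S \<in> sets lebesgue" "T \<in> sets lebesgue" "S \<times> T \<in> sets lebesgue"
    using S T by (auto intro!: open_in_sets_lebesgue open_Times)
  have "(\<lambda>p. if p \<in> S \<times> T then case_prod k p else 0) \<in> borel_measurable lebesgue"
    by (rule borel_measurable_if_I[OF _ sets(3)]) (use k in simp)
  then obtain g where g: "g \<in> borel_measurable lborel"
    "AE p in lborel. (if p \<in> S \<times> T then case_prod k p else 0) = g p"
    using completion_ex_borel_measurable_real by blast
  define G where "G s t = max m (min M (g (s, t)))" for s t
  have "AE p in lborel. p \<in> S \<times> T \<longrightarrow> m \<le> case_prod k p \<and> case_prod k p \<le> M"
    by (rule AE_lebesgue_on_imp_lborel[OF sets(3)]) (use b in \<open>simp add: case_prod_beta'\<close>)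
  with g(2) have "AE p in lborel. fst p \<in> S \<longrightarrow> snd p \<in> T \<longrightarrow> k (fst p) (snd p) = G (fst p) (snd p)"
    by eventually_elim (auto simp: G_def)
  from AE_lborel_pair[OF this]
  have *: "AE s in lborel. AE t in lborel. s \<in> S \<longrightarrow> t \<in> T \<longrightarrow> k s t = G s t"
    "AE t in lborel. AE s in lborel. s \<in> S \<longrightarrow> t \<in> T \<longrightarrow> k s t = G s t" .
  show ?thesis
  proof
    have id: "(\<lambda>t. t) \<in> borel_measurable (lebesgue_on U)" for U :: "'c::euclidean_space set"
      by (intro measurable_restrict_space1 measurable_completion) simp
    have "(\<lambda>p. (fst p, snd p)) \<in> borel_measurable (lebesgue_on S \<Otimes>\<^sub>M lebesgue_on T)"
      by (intro borel_measurable_Pair measurable_compose[OF measurable_fst id]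
          measurable_compose[OF measurable_snd id])
    then have "(\<lambda>p. g (fst p, snd p)) \<in> borel_measurable (lebesgue_on S \<Otimes>\<^sub>M lebesgue_on T)"
      by (rule measurable_compose) (use g(1) in simp)
    then show "(\<lambda>(s, t). G s t) \<in> borel_measurable (lebesgue_on S \<Otimes>\<^sub>M lebesgue_on T)"
      unfolding G_def by (simp add: case_prod_beta')
    show "m \<le> G s t" "G s t \<le> M" for s t using mM by (auto simp: G_def)
    show "AE s in lebesgue_on S. AE t in lebesgue_on T. k s t = G s t"
    proof (rule AE_lborel_imp_lebesgue_on[OF sets(1)])
      show "AE s in lborel. s \<in> S \<longrightarrow> (AE t in lebesgue_on T. k s t = G s t)"
        using *(1) by (rule eventually_mono)
          (intro impI AE_lborel_imp_lebesgue_on[OF sets(2)], erule eventually_mono, simp)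
    qed
    show "AE t in lebesgue_on T. AE s in lebesgue_on S. k s t = G s t"
    proof (rule AE_lborel_imp_lebesgue_on[OF sets(2)])
      show "AE t in lborel. t \<in> T \<longrightarrow> (AE s in lebesgue_on S. k s t = G s t)"
        using *(2) by (rule eventually_mono)
          (intro impI AE_lborel_imp_lebesgue_on[OF sets(1)], erule eventually_mono, simp)
    qed
  qed
qed

lemma AE_lebesgue_on_open_ex:
  fixes S :: "'a::euclidean_space set"
  assumes S: "open S" "S \<noteq> {}" and ae: "AE t in lebesgue_on S. P t"
  shows "\<exists>t\<in>S. P t"
proof (rule ccontr)
  assume no: "\<not> (\<exists>t\<in>S. P t)"
  have Sm: "S \<in> sets lebesgue" using S(1) by (rule open_in_sets_lebesgue)
  have "AE t in lebesgue. t \<in> S \<longrightarrow> P t" using ae Sm by (simp add: AE_restrict_space_iff)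
  then have "AE t in lebesgue. t \<notin> S" by eventually_elim (use no in auto)
  then have "S \<in> null_sets lebesgue"
    using Sm by (simp add: AE_iff_null_sets)
  then have "negligible S" by (simp add: negligible_iff_null_sets)
  then show False using open_not_negligible[OF S] by simp
qed

text \<open>The finite intersections of a countable topological basis; every Lebesgue set differs from a Borel
  set by a null set.\<close>

lemma lebesgue_on_countable_generator:
  fixes S :: "'a::euclidean_space set"
  assumes S: "open S"
  obtains \<G> where "countable \<G>" "\<G> \<subseteq> sets (lebesgue_on S)" "space (lebesgue_on S) \<in> \<G>" "Int_stable \<G>"
    "\<And>E. E \<in> sets (lebesgue_on S) \<Longrightarrow>
       \<exists>F\<in>sigma_sets (space (lebesgue_on S)) \<G>. AE t in lebesgue_on S. t \<in> E \<longleftrightarrow> t \<in> F"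
proof -
  obtain B :: "'a set set" where B: "countable B" "topological_basis B"
    using ex_countable_basis by blast
  define \<G> where "\<G> = (\<lambda>F. S \<inter> \<Inter>F) ` {F. F \<subseteq> B \<and> finite F}"
  have Sm: "S \<in> sets lebesgue" using S by (rule open_in_sets_lebesgue)
  have Bo: "b \<in> B \<Longrightarrow> open b" for b using B(2) topological_basis_open by blast
  show ?thesis
  proof
    show "countable \<G>"
      unfolding \<G>_def using countable_Collect_finite_subset[OF B(1)] by (intro countable_image) (simp add: conj_commute)
    show "\<G> \<subseteq> sets (lebesgue_on S)"
    proof
      fix E assume "E \<in> \<G>"
      then obtain F where F: "F \<subseteq> B" "finite F" "E = S \<inter> \<Inter>F" by (auto simp: \<G>_def)
      then have "open E" using S Bo by (auto intro!: open_Int open_Inter)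
      then have "E \<in> sets lebesgue" by (rule open_in_sets_lebesgue)
      then show "E \<in> sets (lebesgue_on S)" using F Sm by (simp add: sets_restrict_space_iff)
    qed
    show "space (lebesgue_on S) \<in> \<G>"
      unfolding \<G>_def by (rule image_eqI[of _ _ "{}"]) auto
    show "Int_stable \<G>"
      unfolding Int_stable_def
    proof (intro ballI)
      fix X Y assume "X \<in> \<G>" "Y \<in> \<G>"
      then obtain F F' where F: "F \<subseteq> B" "finite F" "X = S \<inter> \<Inter>F" "F' \<subseteq> B" "finite F'" "Y = S \<inter> \<Inter>F'"
        by (auto simp: \<G>_def)
      then have "X \<inter> Y = S \<inter> \<Inter>(F \<union> F')" by auto
      with F show "X \<inter> Y \<in> \<G>" unfolding \<G>_def by (intro image_eqI[of _ _ "F \<union> F'"]) auto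
    qed
    fix E assume E: "E \<in> sets (lebesgue_on S)"
    then have ES: "E \<subseteq> S" "E \<in> sets lebesgue" using Sm by (auto simp: sets_restrict_space_iff)
    obtain A Z Z' where A: "E = A \<union> Z" "Z \<subseteq> Z'" "Z' \<in> null_sets lborel" "A \<in> sets lborel"
      using sets_completionE[OF ES(2)] by blast
    have sp: "space (lebesgue_on S) = S" by simp
    have borel: "sets (borel :: 'a measure) = sigma_sets UNIV B"
      by (subst borel_eq_countable_basis[OF B]) simp
    have "A \<in> sigma_sets UNIV B" using A(4) by (simp flip: borel)
    moreover have "S \<in> sigma_sets UNIV B" using borel_open[OF S] by (simp flip: borel)
    ultimately have mem: "S \<inter> A \<in> sigma_sets S ((\<inter>) S ` B)"
      using sigma_sets_Int[of S UNIV B] by auto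
    have sub: "(\<inter>) S ` B \<subseteq> \<G>"
    proof
      fix X assume "X \<in> (\<inter>) S ` B"
      then obtain b where "b \<in> B" "X = S \<inter> b" by auto
      then show "X \<in> \<G>" unfolding \<G>_def by (intro image_eqI[of _ _ "{b}"]) auto
    qed
    have "S \<inter> A \<in> sigma_sets S \<G>"
      by (rule subsetD[OF sigma_sets_mono'[OF sub] mem])
    moreover have "AE t in lebesgue_on S. t \<in> E \<longleftrightarrow> t \<in> S \<inter> A"
    proof (rule AE_lborel_imp_lebesgue_on[OF Sm])
      show "AE t in lborel. t \<in> S \<longrightarrow> (t \<in> E) = (t \<in> S \<inter> A)"
        using AE_not_in[OF A(3)] by eventually_elim (use A in auto)
    qed
    ultimately show "\<exists>F\<in>sigma_sets (space (lebesgue_on S)) \<G>. AE t in lebesgue_on S. t \<in> E \<longleftrightarrow> t \<in> F"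
      unfolding sp by blast
  qed
qed

section \<open>Convergence of the stopped iterates\<close>

text \<open>The data of the problem together with a solution \<open>xs\<close> and regularised kernels \<open>G\<close>. The noise level
  and the noisy data remain variable, as the bounds have to be uniform in them.\<close>

locale osem_problem =
  fixes \<Omega> \<Sigma> :: "'a::euclidean_space set" and N :: nat
    and a G :: "nat \<Rightarrow> 'a \<Rightarrow> 'a \<Rightarrow> real" and y :: "nat \<Rightarrow> 'a \<Rightarrow> real"
    and x0 xs :: "'a \<Rightarrow> real" and m M m1 M1 \<tau> \<gamma> :: real
  assumes domains: "open \<Omega>" "bounded \<Omega>" "open \<Sigma>" "bounded \<Sigma>"
    and N: "0 < N"
    and kernel: "\<And>j. j < N \<Longrightarrow> kernel_pair (lebesgue_on \<Omega>) (lebesgue_on \<Sigma>) (G j) m M"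
    and a_eq: "\<And>j. j < N \<Longrightarrow> AE s in lebesgue_on \<Sigma>. AE t in lebesgue_on \<Omega>. a j s t = G j s t"
      "\<And>j. j < N \<Longrightarrow> AE t in lebesgue_on \<Omega>. AE s in lebesgue_on \<Sigma>. a j s t = G j s t"
    and y: "\<And>j. j < N \<Longrightarrow> integrable (lebesgue_on \<Sigma>) (y j)"
      "\<And>j. j < N \<Longrightarrow> (LINT s|lebesgue_on \<Sigma>. y j s) = 1"
    and start: "x0 \<in> prob_densities \<Omega>"
    and xs: "solves_system \<Omega> \<Sigma> N a y xs" "AE t in lebesgue_on \<Omega>. 0 \<le> xs t"
      "KL_dist \<Omega> xs x0 < \<infinity>"
    and m1: "0 < m1" and \<tau>: "1 < \<tau>"
    and \<gamma>: "\<gamma> = max \<bar>ln (m1 / M)\<bar> \<bar>ln (M1 / m)\<bar>"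
begin

abbreviation P :: "'a measure" where "P \<equiv> lebesgue_on \<Omega>"
abbreviation Q :: "'a measure" where "Q \<equiv> lebesgue_on \<Sigma>"
abbreviation "x \<equiv> loping_osem \<Omega> \<Sigma> N a \<tau> \<gamma> x0"
abbreviation "noisy \<equiv> noisy_data \<Sigma> N m1 M1 y"

lemma sets_lebesgue: "\<Omega> \<in> sets lebesgue" "\<Sigma> \<in> sets lebesgue"
  using domains open_in_sets_lebesgue by auto

lemma finite_PQ: "finite_measure P" "finite_measure Q"
  using domains by (auto intro!: finite_measure_lebesgue_on lmeasurable_open)

lemma kernel_op_eq:
  assumes j: "j < N" and v: "v \<in> borel_measurable P"
  shows "AE s in Q. kernel_op \<Omega> (a j) v s = kernel_integral P (G j) v s"
  using a_eq(1)[OF j] AE_space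
proof eventually_elim
  case (elim s)
  interpret K: kernel_pair P Q "G j" m M by (rule kernel[OF j])
  have [measurable]: "s \<in> space Q" by (rule elim(2))
  note v [measurable]
  have "(\<lambda>t. G j s t * v t) \<in> borel_measurable P" by measurable
  then show ?case
    unfolding kernel_op_def kernel_integral_def
    by (rule LINT_lebesgue_on_cong_AE[OF sets_lebesgue(1)])
      (use elim(1) in \<open>auto elim!: eventually_mono\<close>)
qed

lemma kernel_op_measurable:
  assumes j: "j < N" and v: "v \<in> borel_measurable P"
  shows "kernel_op \<Omega> (a j) v \<in> borel_measurable Q"
proof -
  interpret K: kernel_pair P Q "G j" m M by (rule kernel[OF j])
  show ?thesis
    by (rule lebesgue_on_measurable_cong_AE[OF sets_lebesgue(2) K.T_measurable[OF v]])
      (use kernel_op_eq[OF j v] in \<open>auto elim!: eventually_mono\<close>)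
qed

lemma KL_dist_eq:
  assumes j: "j < N" and v: "v \<in> borel_measurable P"
  shows "KL_dist \<Sigma> u (kernel_op \<Omega> (a j) v)
     = (\<integral>\<^sup>+ s. KL_integrand (u s) (kernel_integral P (G j) v s) \<partial>Q)"
  unfolding KL_dist_def
  by (rule nn_integral_cong_AE) (use kernel_op_eq[OF j v] in \<open>auto elim!: eventually_mono\<close>)

lemma update_eq:
  assumes j: "j < N" and v: "v \<in> borel_measurable P" and u: "u \<in> borel_measurable Q"
  shows "AE t in P. (LINT s|Q. a j s t * u s / kernel_op \<Omega> (a j) v s)
     = adjoint_integral Q (G j) (\<lambda>s. u s / kernel_integral P (G j) v s) t"
  using a_eq(2)[OF j] AE_space
proof eventually_elim
  case (elim t)
  interpret K: kernel_pair P Q "G j" m M by (rule kernel[OF j])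
  have [measurable]: "t \<in> space P" by (rule elim(2))
  note v [measurable] u [measurable]
  have "(\<lambda>s. G j s t * (u s / kernel_integral P (G j) v s)) \<in> borel_measurable Q" by measurable
  then show ?case
    unfolding adjoint_integral_def
    by (rule LINT_lebesgue_on_cong_AE[OF sets_lebesgue(2)])
      (use elim(1) kernel_op_eq[OF j v] in eventually_elim, simp)
qed

lemma xs_solves:
  assumes j: "j < N"
  shows "AE s in Q. kernel_integral P (G j) xs s = y j s"
proof -
  have "AE s in Q. kernel_op \<Omega> (a j) xs s = y j s" "xs \<in> borel_measurable P"
    using xs(1) j by (auto simp: solves_system_def)
  then show ?thesis using kernel_op_eq[OF j, of xs] by (auto elim: eventually_elim2)
qed

lemma xs_density: "prob_density P xs"
proof -
  interpret K: kernel_pair P Q "G 0" m M by (rule kernel[OF N])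
  have i: "integrable P xs" using xs(1) by (simp add: solves_system_def)
  have [measurable]: "xs \<in> borel_measurable P" "y 0 \<in> borel_measurable Q" using i y[OF N] by auto
  have "(LINT s|Q. kernel_integral P (G 0) xs s) = (LINT s|Q. y 0 s)"
    by (rule integral_cong_AE) (use xs_solves[OF N] in auto)
  then show ?thesis using K.integral_T[OF i] y(2)[OF N] i xs(2) by (simp add: prob_density_def)
qed

lemma x_Suc:
  "x \<delta> yd (Suc k) = (\<lambda>t. x \<delta> yd k t *
     (if KL_dist \<Sigma> (yd (k mod N)) (kernel_op \<Omega> (a (k mod N)) (x \<delta> yd k)) > ennreal (\<tau> * \<gamma> * \<delta> (k mod N))
      then LINT s|Q. a (k mod N) s t * yd (k mod N) s / kernel_op \<Omega> (a (k mod N)) (x \<delta> yd k) s else 1))"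
  by (rule ext) (simp add: Let_def)

declare loping_osem.simps(2) [simp del]

lemma x_measurable:
  assumes noisy: "noisy \<delta> yd"
  shows "x \<delta> yd k \<in> borel_measurable P"
proof (induction k)
  case 0
  then show ?case using start by (auto simp: prob_densities_def)
next
  case (Suc k)
  have j: "k mod N < N" using N by simp
  interpret K: kernel_pair P Q "G (k mod N)" m M by (rule kernel[OF j])
  have yd: "yd (k mod N) \<in> borel_measurable Q" using noisy j by (auto simp: noisy_data_def)
  note yd [measurable] Suc [measurable]
  show ?case
  proof (cases "KL_dist \<Sigma> (yd (k mod N)) (kernel_op \<Omega> (a (k mod N)) (x \<delta> yd k)) > ennreal (\<tau> * \<gamma> * \<delta> (k mod N))")
    case True
    have "(\<lambda>t. x \<delta> yd k t * adjoint_integral Q (G (k mod N))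
        (\<lambda>s. yd (k mod N) s / kernel_integral P (G (k mod N)) (x \<delta> yd k) s) t) \<in> borel_measurable P"
      by measurable
    then show ?thesis
      by (rule lebesgue_on_measurable_cong_AE[OF sets_lebesgue(1)])
        (use update_eq[OF j Suc yd] True in \<open>auto simp: x_Suc elim!: eventually_mono\<close>)
  next
    case False
    then show ?thesis using Suc by (simp add: x_Suc)
  qed
qed

text \<open>The iteration with the raw kernels is a run for the regularised ones.\<close>

lemma loping_run:
  assumes noisy: "noisy \<delta> yd"
  shows "loping_run P Q N G y yd \<delta> m M m1 M1 \<tau> \<gamma> xs (x \<delta> yd)"
proof -
  interpret P: finite_measure P by (rule finite_PQ)
  interpret Q: finite_measure Q by (rule finite_PQ)
  note nd = noisy[unfolded noisy_data_def, rule_format]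
  note xm = x_measurable[OF noisy]
  show ?thesis
  proof (intro loping_run.intro loping_run_axioms.intro finite_PQ)
    show "0 < N" "0 < m1" "1 < \<tau>" "\<gamma> = max \<bar>ln (m1 / M)\<bar> \<bar>ln (M1 / m)\<bar>" by (fact N m1 \<tau> \<gamma>)+
    show "prob_density P xs" by (rule xs_density)
    show "prob_density P (x \<delta> yd 0)" using start by (simp add: prob_density_def prob_densities_def)
    show "(\<integral>\<^sup>+ t. KL_integrand (xs t) (x \<delta> yd 0 t) \<partial>P) < \<infinity>"
      using xs(3) by (simp add: KL_dist_def)
    show "x \<delta> yd k \<in> borel_measurable P" for k by (rule xm)
    fix j assume j: "j < N"
    show "kernel_pair P Q (G j) m M" by (rule kernel[OF j])
    show "integrable Q (y j)" by (rule y(1)[OF j])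
    show "AE s in Q. m1 \<le> yd j s \<and> yd j s \<le> M1" "0 < \<delta> j" "(LINT s|Q. \<bar>y j s - yd j s\<bar>) \<le> \<delta> j"
      using nd[OF j] by auto
    have "AE s in Q. 0 \<le> yd j s" using nd[OF j] m1 by (auto elim!: eventually_mono)
    then show "prob_density Q (yd j)" using nd[OF j] by (simp add: prob_density_def)
    show "AE s in Q. kernel_integral P (G j) xs s = y j s" by (rule xs_solves[OF j])
  next
    fix k
    have j: "k mod N < N" using N by simp
    have ydm: "yd (k mod N) \<in> borel_measurable Q" using nd[OF j] by auto
    { assume "ennreal (\<tau> * \<gamma> * \<delta> (k mod N)) < (\<integral>\<^sup>+ s. KL_integrand (yd (k mod N) s)
          (kernel_integral P (G (k mod N)) (x \<delta> yd k) s) \<partial>Q)"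
      then show "AE t in P. x \<delta> yd (Suc k) t = x \<delta> yd k t * adjoint_integral Q (G (k mod N))
           (\<lambda>s. yd (k mod N) s / kernel_integral P (G (k mod N)) (x \<delta> yd k) s) t"
        using update_eq[OF j xm[of k] ydm] by (auto simp: x_Suc KL_dist_eq[OF j xm] elim!: eventually_mono) }
    { assume "\<not> ennreal (\<tau> * \<gamma> * \<delta> (k mod N)) < (\<integral>\<^sup>+ s. KL_integrand (yd (k mod N) s)
          (kernel_integral P (G (k mod N)) (x \<delta> yd k) s) \<partial>Q)"
      then show "x \<delta> yd (Suc k) = x \<delta> yd k"
        by (simp add: x_Suc KL_dist_eq[OF j xm]) }
  qed
qed

abbreviation "kstar \<delta> yd \<equiv> stop_index \<Omega> N (x \<delta> yd)"

lemma stop_indices_eq: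
  assumes noisy: "noisy \<delta> yd"
  shows "stop_indices \<Omega> N (x \<delta> yd) = {q * N | q. loping_run.stationary P N (x \<delta> yd) (q * N)}"
proof -
  interpret R: loping_run P Q N G y yd \<delta> m M m1 M1 \<tau> \<gamma> xs "x \<delta> yd" by (rule loping_run[OF noisy])
  show ?thesis by (auto simp: stop_indices_def R.stationary_def)
qed

lemma stop_indices_nonempty:
  assumes noisy: "noisy \<delta> yd"
  shows "stop_indices \<Omega> N (x \<delta> yd) \<noteq> {}"
proof -
  interpret R: loping_run P Q N G y yd \<delta> m M m1 M1 \<tau> \<gamma> xs "x \<delta> yd" by (rule loping_run[OF noisy])
  show ?thesis unfolding stop_indices_eq[OF noisy] using R.ex_stationary by blast
qed

lemma kstar_obtain:
  assumes noisy: "noisy \<delta> yd"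
  obtains q where "kstar \<delta> yd = q * N" "loping_run.stationary P N (x \<delta> yd) (q * N)"
    "\<And>q'. q' < q \<Longrightarrow> \<not> loping_run.stationary P N (x \<delta> yd) (q' * N)"
proof -
  obtain k where k: "k \<in> stop_indices \<Omega> N (x \<delta> yd)" using stop_indices_nonempty[OF noisy] by blast
  have "kstar \<delta> yd \<in> stop_indices \<Omega> N (x \<delta> yd)"
    unfolding stop_index_def by (rule LeastI[of "\<lambda>k. k \<in> stop_indices \<Omega> N (x \<delta> yd)", OF k])
  then obtain q where q: "kstar \<delta> yd = q * N" "loping_run.stationary P N (x \<delta> yd) (q * N)"
    unfolding stop_indices_eq[OF noisy] by blast
  have "\<not> loping_run.stationary P N (x \<delta> yd) (q' * N)" if "q' < q" for q'
  proof
    assume "loping_run.stationary P N (x \<delta> yd) (q' * N)"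
    then have "q' * N \<in> stop_indices \<Omega> N (x \<delta> yd)" unfolding stop_indices_eq[OF noisy] by blast
    then have "kstar \<delta> yd \<le> q' * N" unfolding stop_index_def by (rule Least_le)
    with q(1) that N show False by simp
  qed
  with q that show ?thesis by blast
qed

lemma kstar_bound:
  assumes noisy: "noisy \<delta> yd"
  shows "real (kstar \<delta> yd)
    \<le> (real N * enn2real (KL_dist \<Omega> xs x0) / ((\<tau> - 1) * \<gamma>)) / Min (\<delta> ` {..<N})"
proof -
  interpret R: loping_run P Q N G y yd \<delta> m M m1 M1 \<tau> \<gamma> xs "x \<delta> yd" by (rule loping_run[OF noisy])
  obtain q where q: "kstar \<delta> yd = q * N" "\<And>q'. q' < q \<Longrightarrow> \<not> R.stationary (q' * N)"
    by (rule kstar_obtain[OF noisy]) (rule that)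
  define d where "d = Min (\<delta> ` {..<N})"
  have d: "0 < d" "\<And>j. j < N \<Longrightarrow> d \<le> \<delta> j"
    unfolding d_def using N R.\<delta> by (subst Min_gr_iff) (auto simp: lessThan_empty_iff)
  have b: "real q * ((\<tau> - 1) * \<gamma> * d) \<le> enn2real (KL_dist \<Omega> xs x0)"
    using R.cycles_bound[of q d] q(2) d(2) by (simp add: KL_dist_def)
  show ?thesis
  proof (cases "\<gamma> = 0")
    case True
    then have "q = 0" using q(2) R.always_stationary by (metis gr0I)
    then show ?thesis using q True by simp
  next
    case False
    then have c: "0 < (\<tau> - 1) * \<gamma>" using R.\<gamma>_nonneg \<tau> by simp
    have "real N * (real q * ((\<tau> - 1) * \<gamma> * d)) \<le> real N * enn2real (KL_dist \<Omega> xs x0)"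
      using b by (intro mult_left_mono) auto
    then have "real N * real q * d * ((\<tau> - 1) * \<gamma>) \<le> real N * enn2real (KL_dist \<Omega> xs x0)"
      by (simp add: mult_ac)
    then have "real N * real q * d \<le> real N * enn2real (KL_dist \<Omega> xs x0) / ((\<tau> - 1) * \<gamma>)"
      by (subst pos_le_divide_eq[OF c])
    then have "real N * real q \<le> real N * enn2real (KL_dist \<Omega> xs x0) / ((\<tau> - 1) * \<gamma>) / d"
      by (subst pos_le_divide_eq[OF d(1)])
    then show ?thesis using q(1) by (simp add: d_def mult.commute)
  qed
qed

lemma kstar_residual:
  assumes noisy: "noisy \<delta> yd" and j: "j < N"
  shows "KL_dist \<Sigma> (yd j) (kernel_op \<Omega> (a j) (x \<delta> yd (kstar \<delta> yd))) \<le> ennreal (\<tau> * \<gamma> * \<delta> j)"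
proof -
  interpret R: loping_run P Q N G y yd \<delta> m M m1 M1 \<tau> \<gamma> xs "x \<delta> yd" by (rule loping_run[OF noisy])
  obtain q where q: "kstar \<delta> yd = q * N" "R.stationary (q * N)"
    by (rule kstar_obtain[OF noisy]) (rule that)
  show ?thesis
    using R.stationary_residual[OF q(2) j] unfolding q(1) KL_dist_eq[OF j x_measurable[OF noisy]] R.KL_def .
qed

text \<open>\<open>residual_integral_bound\<close> with \<open>e'\<close> chosen first, and then the noise level so small that each of
  the three terms is below \<open>e / 3\<close>.\<close>

lemma stopped_residual_small:
  assumes j: "j < N" and e: "0 < e"
  shows "\<exists>\<eta>>0. \<forall>\<delta> yd. noisy \<delta> yd \<and> (\<forall>i<N. \<delta> i < \<eta>) \<longrightarrow>
    (LINT s|Q. \<bar>kernel_op \<Omega> (a j) (x \<delta> yd (kstar \<delta> yd)) s - y j s\<bar>) < e"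
proof -
  interpret K: kernel_pair P Q "G j" m M by (rule kernel[OF j])
  define c where "c = 4 * max M1 M * (\<tau> * \<gamma>)"
  have \<gamma>0: "0 \<le> \<gamma>" by (simp add: \<gamma>)
  have c0: "0 \<le> c" using \<gamma>0 \<tau> K.M_pos by (simp add: c_def)
  define \<mu> where "\<mu> = measure Q (space Q)"
  have \<mu>0: "0 \<le> \<mu>" by (simp add: \<mu>_def)
  define e' where "e' = e / (3 * (\<mu> + 1))"
  have e': "0 < e'" using e \<mu>0 by (simp add: e'_def)
  have "e' * (\<mu> + 1) = e / 3" using \<mu>0 by (simp add: e'_def field_simps)
  then have e\<mu>: "e' * \<mu> < e / 3" using e' by (simp add: algebra_simps)
  define \<eta> where "\<eta> = min (e / 3) (e * e' / (3 * (c + 1)))"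
  have \<eta>: "0 < \<eta>" using e e' c0 by (simp add: \<eta>_def)
  have "(LINT s|Q. \<bar>kernel_op \<Omega> (a j) (x \<delta> yd (kstar \<delta> yd)) s - y j s\<bar>) < e"
    if noisy: "noisy \<delta> yd" and small: "\<forall>i<N. \<delta> i < \<eta>" for \<delta> yd
  proof -
    interpret R: loping_run P Q N G y yd \<delta> m M m1 M1 \<tau> \<gamma> xs "x \<delta> yd" by (rule loping_run[OF noisy])
    have xm: "x \<delta> yd k \<in> borel_measurable P" for k by (rule x_measurable[OF noisy])
    have [measurable]: "y j \<in> borel_measurable Q" using y[OF j] by auto
    note xm [measurable] kernel_op_measurable[OF j xm, measurable]
    let ?X = "x \<delta> yd (kstar \<delta> yd)"
    have "R.KL j (kstar \<delta> yd) \<le> ennreal (\<tau> * \<gamma> * \<delta> j)"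
      using kstar_residual[OF noisy j] unfolding R.KL_def KL_dist_eq[OF j xm] .
    from R.residual_integral_bound[OF j this e']
    have "(LINT s|Q. \<bar>kernel_integral P (G j) ?X s - y j s\<bar>) \<le> e' * \<mu> + c * \<delta> j / e' + \<delta> j"
      by (simp add: \<mu>_def c_def mult.assoc)
    moreover have "(LINT s|Q. \<bar>kernel_op \<Omega> (a j) ?X s - y j s\<bar>) = (LINT s|Q. \<bar>kernel_integral P (G j) ?X s - y j s\<bar>)"
      by (rule integral_cong_AE) (use kernel_op_eq[OF j xm[of "kstar \<delta> yd"]] in \<open>auto elim!: eventually_mono\<close>)
    moreover have "c * \<delta> j / e' < e / 3"
    proof -
      have \<delta>j: "0 < \<delta> j" "\<delta> j < e * e' / (3 * (c + 1))" using small j R.\<delta>[OF j] by (auto simp: \<eta>_def)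
      have "c * \<delta> j < (c + 1) * \<delta> j" using \<delta>j by simp
      also have "\<dots> < e * e' / 3" using \<delta>j(2) c0 by (simp add: field_simps)
      finally show ?thesis using e' by (simp add: field_simps)
    qed
    moreover have "\<delta> j < e / 3" using small j by (auto simp: \<eta>_def)
    ultimately show ?thesis using e\<mu> by linarith
  qed
  with \<eta> show ?thesis by blast
qed

lemma stopped_residual_bounded:
  assumes noisy: "noisy \<delta> yd" and j: "j < N"
  shows "AE s in Q. \<bar>kernel_op \<Omega> (a j) (x \<delta> yd k) s - y j s\<bar> \<le> M"
proof -
  interpret R: loping_run P Q N G y yd \<delta> m M m1 M1 \<tau> \<gamma> xs "x \<delta> yd" by (rule loping_run[OF noisy])
  interpret K: kernel_pair P Q "G j" m M by (rule kernel[OF j])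
  show ?thesis
    using kernel_op_eq[OF j x_measurable[OF noisy], of k] xs_solves[OF j] AE_space
  proof eventually_elim
    case (elim s)
    then show ?case
      using K.prob_density_T_bounds[OF R.X_density[of k] elim(3)]
        K.prob_density_T_bounds[OF xs_density elim(3)] K.m_pos by linarith
  qed
qed

text \<open>Interpolation: \<open>\<bar>w\<bar>\<^sup>p \<le> M\<^sup>p\<^sup>-\<^sup>1 \<bar>w\<bar>\<close> for \<open>\<bar>w\<bar> \<le> M\<close>.\<close>

lemma stopped_residual_Lp:
  assumes j: "j < N" and p: "1 \<le> p" and e: "0 < e"
  shows "\<exists>\<eta>>0. \<forall>\<delta> yd. noisy \<delta> yd \<and> (\<forall>i<N. \<delta> i < \<eta>) \<longrightarrow>
    (\<lambda>s. kernel_op \<Omega> (a j) (x \<delta> yd (kstar \<delta> yd)) s - y j s) \<in> Lp_space \<Sigma> p \<and>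
    Lp_norm \<Sigma> p (\<lambda>s. kernel_op \<Omega> (a j) (x \<delta> yd (kstar \<delta> yd)) s - y j s) < e"
proof -
  interpret K: kernel_pair P Q "G j" m M by (rule kernel[OF j])
  define A where "A = M powr (p - 1)"
  have A: "0 < A" using K.M_pos by (simp add: A_def)
  have "0 < e powr p / A" using A e by simp
  from stopped_residual_small[OF j this] obtain \<eta> where \<eta>: "0 < \<eta>"
    "\<And>\<delta> yd. noisy \<delta> yd \<Longrightarrow> \<forall>i<N. \<delta> i < \<eta> \<Longrightarrow>
       (LINT s|Q. \<bar>kernel_op \<Omega> (a j) (x \<delta> yd (kstar \<delta> yd)) s - y j s\<bar>) < e powr p / A"
    by blast
  have "(\<lambda>s. kernel_op \<Omega> (a j) (x \<delta> yd (kstar \<delta> yd)) s - y j s) \<in> Lp_space \<Sigma> p \<and>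
    Lp_norm \<Sigma> p (\<lambda>s. kernel_op \<Omega> (a j) (x \<delta> yd (kstar \<delta> yd)) s - y j s) < e"
    if noisy: "noisy \<delta> yd" and small: "\<forall>i<N. \<delta> i < \<eta>" for \<delta> yd
  proof -
    define w where "w = (\<lambda>s. kernel_op \<Omega> (a j) (x \<delta> yd (kstar \<delta> yd)) s - y j s)"
    have [measurable]: "y j \<in> borel_measurable Q" using y[OF j] by auto
    note kernel_op_measurable[OF j x_measurable[OF noisy], measurable]
    have wm [measurable]: "w \<in> borel_measurable Q" unfolding w_def by measurable
    have wM: "AE s in Q. \<bar>w s\<bar> \<le> M"
      unfolding w_def by (rule stopped_residual_bounded[OF noisy j])
    have wp: "integrable Q (\<lambda>s. \<bar>w s\<bar> powr p)"
      by (rule K.integrable_bounded_Q[of _ "M powr p"])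
        (use wM p in \<open>auto elim!: eventually_mono intro: powr_mono2\<close>)
    have wi: "integrable Q (\<lambda>s. \<bar>w s\<bar>)"
      by (rule K.integrable_bounded_Q[of _ M]) (use wM in auto)
    have "(LINT s|Q. \<bar>w s\<bar> powr p) \<le> (LINT s|Q. A * \<bar>w s\<bar>)"
    proof (rule integral_mono_AE[OF wp])
      show "AE s in Q. \<bar>w s\<bar> powr p \<le> A * \<bar>w s\<bar>"
        using wM
      proof eventually_elim
        case (elim s)
        show ?case
        proof (cases "w s = 0")
          case False
          then have "\<bar>w s\<bar> powr p = \<bar>w s\<bar> * \<bar>w s\<bar> powr (p - 1)"
            using powr_mult_base[of "\<bar>w s\<bar>" "p - 1"] by simp
          also have "\<dots> \<le> \<bar>w s\<bar> * A"
            unfolding A_def using elim p by (intro mult_left_mono powr_mono2) auto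
          finally show ?thesis by (simp add: mult.commute)
        qed simp
      qed
    qed (use wi in simp)
    also have "\<dots> < e powr p"
      using \<eta>(2)[OF noisy small] A by (simp add: w_def field_simps)
    finally have "(LINT s|Q. \<bar>w s\<bar> powr p) powr (1 / p) < (e powr p) powr (1 / p)"
      using p by (intro powr_less_mono2) auto
    also have "\<dots> = e" using p e by (simp add: powr_powr)
    finally show ?thesis using wm wp unfolding w_def[symmetric] by (simp add: Lp_space_def Lp_norm_def)
  qed
  with \<eta>(1) show ?thesis by blast
qed

text \<open>The subsequence and \<open>z\<close> come from \<open>nonneg_Lp_weak_compactness\<close>. Testing with the bounded functions
  \<open>G j s\<close> gives pointwise convergence of \<open>A x\<^sub>l\<close> to \<open>A z\<close>, and by dominated convergence
  \<open>\<parallel>A x\<^sub>l - y\<parallel>\<^sub>1 \<longrightarrow> \<parallel>A z - y\<parallel>\<^sub>1\<close>; the left-hand side tends to zero since the residuals do.\<close>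

theorem stopped_weak_convergence:
  fixes \<delta>s :: "nat \<Rightarrow> nat \<Rightarrow> real" and ys :: "nat \<Rightarrow> nat \<Rightarrow> 'a \<Rightarrow> real"
  assumes noisy: "\<And>l. noisy (\<delta>s l) (ys l)"
    and lim: "\<And>j. j < N \<Longrightarrow> (\<lambda>l. \<delta>s l j) \<longlonglongrightarrow> 0"
    and p: "1 < p"
    and Lp: "\<And>l. x (\<delta>s l) (ys l) (kstar (\<delta>s l) (ys l)) \<in> Lp_space \<Omega> p"
    and B: "\<And>l. Lp_norm \<Omega> p (x (\<delta>s l) (ys l) (kstar (\<delta>s l) (ys l))) \<le> B"
  shows "\<exists>(r :: nat \<Rightarrow> nat) z. strict_mono r \<and>
           weakly_converges_Lp \<Omega> p (\<lambda>l. x (\<delta>s (r l)) (ys (r l)) (kstar (\<delta>s (r l)) (ys (r l)))) z \<and>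
           solves_system \<Omega> \<Sigma> N a y z"
proof -
  interpret P: finite_measure P by (rule finite_PQ)
  interpret Q: finite_measure Q by (rule finite_PQ)
  define X where "X l = x (\<delta>s l) (ys l) (kstar (\<delta>s l) (ys l))" for l
  have Xm: "X l \<in> borel_measurable P" for l
    unfolding X_def by (rule x_measurable[OF noisy])
  have Xd: "prob_density P (X l)" for l
  proof -
    interpret R: loping_run P Q N G y "ys l" "\<delta>s l" m M m1 M1 \<tau> \<gamma> xs "x (\<delta>s l) (ys l)"
      by (rule loping_run[OF noisy])
    show ?thesis unfolding X_def by (rule R.X_density)
  qed
  have X0: "AE t in P. 0 \<le> X l t" for l using Xd by (simp add: prob_density_def)
  \<comment> \<open>The iterates are nonnegative only almost everywhere; the compactness theorem
    is about functions that are nonnegative everywhere.\<close>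
  define f where "f l t = max 0 (X l t)" for l t
  note Xm [measurable]
  have fm [measurable]: "f l \<in> borel_measurable P" for l unfolding f_def by measurable
  have fX: "AE t in P. f l t = X l t" for l
    using X0[of l] by (auto elim!: eventually_mono simp: f_def)
  have f0: "0 \<le> f l t" for l t by (simp add: f_def)
  have Xp: "integrable P (\<lambda>t. \<bar>X l t\<bar> powr p)" for l
    using Lp by (simp add: X_def Lp_space_def)
  have fXp: "AE t in P. f l t powr p = \<bar>X l t\<bar> powr p" for l
    using X0[of l] by (auto elim!: eventually_mono simp: f_def)
  have fp: "integrable P (\<lambda>t. f l t powr p)" for l
    using Xp by (subst integrable_cong_AE[OF _ _ fXp]) auto
  have "0 \<le> Lp_norm \<Omega> p (X 0)" by (simp add: Lp_norm_def)
  then have B0: "0 \<le> B" using B[of 0] by (simp add: X_def)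
  have fB: "(LINT t|P. f l t powr p) \<le> B powr p" for l
  proof -
    have "(LINT t|P. f l t powr p) = (LINT t|P. \<bar>X l t\<bar> powr p)"
      by (rule integral_cong_AE[OF _ _ fXp]) auto
    also have "\<dots> = Lp_norm \<Omega> p (X l) powr p"
      using p by (simp add: Lp_norm_def powr_powr)
    also have "\<dots> \<le> B powr p"
      using B[of l] p by (intro powr_mono2) (auto simp: X_def Lp_norm_def)
    finally show ?thesis .
  qed
  obtain \<G> where \<G>: "countable \<G>" "\<G> \<subseteq> sets P" "space P \<in> \<G>" "Int_stable \<G>"
    "\<And>E. E \<in> sets P \<Longrightarrow> \<exists>F\<in>sigma_sets (space P) \<G>. AE t in P. t \<in> E \<longleftrightarrow> t \<in> F"
    by (rule lebesgue_on_countable_generator[OF domains(1)]) (rule that; assumption)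
  have "\<exists>(r :: nat \<Rightarrow> nat) z. strict_mono r \<and> integrable P z \<and> (\<forall>t. 0 \<le> z t) \<and>
    integrable P (\<lambda>t. z t powr p) \<and>
    (\<forall>h\<in>borel_measurable P. integrable P (\<lambda>t. \<bar>h t\<bar> powr (p / (p - 1))) \<longrightarrow>
       (\<lambda>l. LINT t|P. f (r l) t * h t) \<longlonglongrightarrow> (LINT t|P. z t * h t))"
    by (rule P.nonneg_Lp_weak_compactness[OF p fm f0 fp fB \<G>(1-4)]) (rule \<G>(5))
  then obtain r z where r: "strict_mono (r :: nat \<Rightarrow> nat)" and z: "integrable P z" "\<And>t. 0 \<le> z t"
    "integrable P (\<lambda>t. z t powr p)"
    and conv: "\<And>h. h \<in> borel_measurable P \<Longrightarrow> integrable P (\<lambda>t. \<bar>h t\<bar> powr (p / (p - 1))) \<Longrightarrow>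
       (\<lambda>l. LINT t|P. f (r l) t * h t) \<longlonglongrightarrow> (LINT t|P. z t * h t)"
    by blast
  have zm [measurable]: "z \<in> borel_measurable P" using z by auto
  have fX_int: "(LINT t|P. f l t * h t) = (LINT t|P. X l t * h t)"
    if [measurable]: "h \<in> borel_measurable P" for l h
    by (rule integral_cong_AE) (use fX[of l] in \<open>auto elim!: eventually_mono\<close>)
  have weak: "weakly_converges_Lp \<Omega> p (\<lambda>l. X (r l)) z"
    unfolding weakly_converges_Lp_def
  proof (intro conjI allI ballI)
    show "X (r l) \<in> Lp_space \<Omega> p" for l using Lp by (simp add: X_def)
    show "z \<in> Lp_space \<Omega> p" using z by (simp add: Lp_space_def)
    fix h assume "h \<in> Lp_space \<Omega> (p / (p - 1))"
    then have h: "h \<in> borel_measurable P" "integrable P (\<lambda>t. \<bar>h t\<bar> powr (p / (p - 1)))"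
      by (auto simp: Lp_space_def)
    show "(\<lambda>l. LINT t|P. X (r l) t * h t) \<longlonglongrightarrow> (LINT t|P. z t * h t)"
      using conv[OF h] by (simp add: fX_int[OF h(1)])
  qed
  have sol: "AE s in Q. kernel_op \<Omega> (a j) z s = y j s" if j: "j < N" for j
  proof -
    interpret K: kernel_pair P Q "G j" m M by (rule kernel[OF j])
    have [measurable]: "y j \<in> borel_measurable Q" using y[OF j] by auto
    let ?T = "kernel_integral P (G j)"
    have pw: "(\<lambda>l. ?T (X (r l)) s) \<longlonglongrightarrow> ?T z s" if s: "s \<in> space Q" for s
    proof -
      note s [measurable]
      have Gm: "G j s \<in> borel_measurable P" by measurable
      have "integrable P (\<lambda>t. \<bar>G j s t\<bar> powr (p / (p - 1)))"
        by (rule P.integrable_const_bound[of _ "M powr (p / (p - 1))"])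
          (use K.G_abs p in \<open>auto intro!: AE_I2 powr_mono2\<close>)
      from conv[OF Gm this, unfolded fX_int[OF Gm]] show ?thesis
        by (simp add: kernel_integral_def mult.commute)
    qed
    have dct: "(\<lambda>l. LINT s|Q. \<bar>?T (X (r l)) s - y j s\<bar>) \<longlonglongrightarrow> (LINT s|Q. \<bar>?T z s - y j s\<bar>)"
    proof (rule integral_dominated_convergence)
      show "integrable Q (\<lambda>s. M + \<bar>y j s\<bar>)" using y[OF j] by simp
      show "AE s in Q. (\<lambda>l. \<bar>?T (X (r l)) s - y j s\<bar>) \<longlonglongrightarrow> \<bar>?T z s - y j s\<bar>"
        by (intro AE_I2 tendsto_intros pw)
      show "AE s in Q. norm \<bar>?T (X (r l)) s - y j s\<bar> \<le> M + \<bar>y j s\<bar>" for l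
      proof (rule AE_I2)
        fix s assume s: "s \<in> space Q"
        show "norm \<bar>?T (X (r l)) s - y j s\<bar> \<le> M + \<bar>y j s\<bar>"
          using K.prob_density_T_bounds[OF Xd s, of "r l"] K.m_pos by (simp add: abs_if)
      qed
    qed measurable
    have zero: "(\<lambda>l. LINT s|Q. \<bar>?T (X (r l)) s - y j s\<bar>) \<longlonglongrightarrow> 0"
    proof (rule LIMSEQ_I)
      fix e :: real assume "0 < e"
      from stopped_residual_small[OF j this] obtain \<eta> where \<eta>: "0 < \<eta>"
        "\<And>\<delta> yd. noisy \<delta> yd \<Longrightarrow> \<forall>i<N. \<delta> i < \<eta> \<Longrightarrow>
          (LINT s|Q. \<bar>kernel_op \<Omega> (a j) (x \<delta> yd (kstar \<delta> yd)) s - y j s\<bar>) < e" by blast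
      have "\<forall>\<^sub>F l in sequentially. \<forall>i\<in>{..<N}. \<delta>s l i < \<eta>"
        by (intro eventually_ball_finite ballI order_tendstoD(2)[OF lim]) (use \<eta> in auto)
      then obtain l0 where l0: "\<And>l. l0 \<le> l \<Longrightarrow> \<forall>i\<in>{..<N}. \<delta>s l i < \<eta>"
        by (auto simp: eventually_sequentially)
      have "norm ((LINT s|Q. \<bar>?T (X (r l)) s - y j s\<bar>) - 0) < e" if "l0 \<le> l" for l
      proof -
        have "l0 \<le> r l" using that seq_suble[OF r, of l] by linarith
        then have small: "\<forall>i<N. \<delta>s (r l) i < \<eta>" using l0 by auto
        note kernel_op_measurable[OF j Xm, measurable]
        have "(LINT s|Q. \<bar>?T (X (r l)) s - y j s\<bar>) = (LINT s|Q. \<bar>kernel_op \<Omega> (a j) (X (r l)) s - y j s\<bar>)"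
          by (rule integral_cong_AE) (use kernel_op_eq[OF j Xm[of "r l"]] in \<open>auto elim!: eventually_mono\<close>)
        then show ?thesis using \<eta>(2)[OF noisy small] by (simp add: X_def)
      qed
      then show "\<exists>l0. \<forall>l\<ge>l0. norm ((LINT s|Q. \<bar>?T (X (r l)) s - y j s\<bar>) - 0) < e" by blast
    qed
    have Tb: "integrable Q (\<lambda>s. \<bar>?T z s - y j s\<bar>)"
    proof -
      have "integrable Q (?T z)"
      proof (rule K.integrable_bounded_Q)
        show "AE s in Q. \<bar>?T z s\<bar> \<le> M"
        proof (rule AE_I2)
          fix s assume s: "s \<in> space Q"
          have "(\<lambda>l. \<bar>?T (X (r l)) s\<bar>) \<longlonglongrightarrow> \<bar>?T z s\<bar>" by (intro tendsto_intros pw s)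
          then show "\<bar>?T z s\<bar> \<le> M"
          proof (rule LIMSEQ_le_const2)
            show "\<exists>l0. \<forall>l\<ge>l0. \<bar>?T (X (r l)) s\<bar> \<le> M"
              using K.prob_density_T_bounds[OF Xd s] K.m_pos by (smt (verit))
          qed
        qed
      qed measurable
      then show ?thesis using y[OF j] by simp
    qed
    have "(LINT s|Q. \<bar>?T z s - y j s\<bar>) = 0" by (rule LIMSEQ_unique[OF dct zero])
    then have "AE s in Q. \<bar>?T z s - y j s\<bar> = 0"
      using integral_nonneg_eq_0_iff_AE[OF Tb] by simp
    then show ?thesis
      using kernel_op_eq[OF j zm] by eventually_elim simp
  qed
  have "solves_system \<Omega> \<Sigma> N a y z" using sol z(1) by (simp add: solves_system_def)
  with r weak show ?thesis unfolding X_def by blast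
qed

end

theorem theorem4p4:
  fixes \<Omega> \<Sigma> :: "'a::euclidean_space set"
    and N :: nat
    and a :: "nat \<Rightarrow> 'a \<Rightarrow> 'a \<Rightarrow> real"
    and y :: "nat \<Rightarrow> 'a \<Rightarrow> real"
    and x0 :: "'a \<Rightarrow> real"
    and m M m1 M1 \<tau> \<gamma> :: real
    and x :: "(nat \<Rightarrow> real) \<Rightarrow> (nat \<Rightarrow> 'a \<Rightarrow> real) \<Rightarrow> nat \<Rightarrow> 'a \<Rightarrow> real"
    and kstar :: "(nat \<Rightarrow> real) \<Rightarrow> (nat \<Rightarrow> 'a \<Rightarrow> real) \<Rightarrow> nat"
  assumes domains: "open \<Omega>" "bounded \<Omega>" "open \<Sigma>" "bounded \<Sigma>"
    and N: "1 \<le> N"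
    and kernels: "\<forall>j<N. (\<lambda>(s, t). a j s t) \<in> borel_measurable (lebesgue_on (\<Sigma> \<times> \<Omega>))"
    and data: "\<forall>j<N. integrable (lebesgue_on \<Sigma>) (y j)"
    and start: "x0 \<in> prob_densities \<Omega>"
    and A1: "\<forall>j<N. AE t in lebesgue_on \<Omega>. (LINT s|lebesgue_on \<Sigma>. a j s t) = 1"
    and A2: "0 < m" "0 < M"
      "\<forall>j<N. AE (s, t) in lebesgue_on (\<Sigma> \<times> \<Omega>). m \<le> a j s t \<and> a j s t \<le> M"
    and A3: "\<forall>j<N. (LINT s|lebesgue_on \<Sigma>. y j s) = 1"
      "\<exists>M'>0. \<forall>j<N. AE s in lebesgue_on \<Sigma>. y j s \<le> M'"
    and A4: "\<exists>xs. solves_system \<Omega> \<Sigma> N a y xs \<and>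
               (AE t in lebesgue_on \<Omega>. 0 \<le> xs t) \<and>
               \<not> (AE t in lebesgue_on \<Omega>. xs t = 0) \<and>
               KL_dist \<Omega> xs x0 < \<infinity>"
    and m1_M1: "0 < m1" "0 < M1"
    and \<tau>: "1 < \<tau>"
    and \<gamma>: "\<gamma> = max \<bar>ln (m1 / M)\<bar> \<bar>ln (M1 / m)\<bar>"
    and x: "\<And>\<delta> yd. x \<delta> yd = loping_osem \<Omega> \<Sigma> N a \<tau> \<gamma> x0 \<delta> yd"
    and kstar: "\<And>\<delta> yd. kstar \<delta> yd = stop_index \<Omega> N (x \<delta> yd)"
  shows
    \<comment> \<open>(i)\<close>
    "(\<forall>\<delta> yd. noisy_data \<Sigma> N m1 M1 y \<delta> yd \<longrightarrow> stop_indices \<Omega> N (x \<delta> yd) \<noteq> {}) \<and>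
    \<comment> \<open>(ii)\<close>
     (\<exists>C::real. \<forall>\<delta> yd. noisy_data \<Sigma> N m1 M1 y \<delta> yd \<longrightarrow>
        real (kstar \<delta> yd) \<le> C / Min (\<delta> ` {..<N})) \<and>
    \<comment> \<open>(iii)\<close>
     (\<forall>\<delta> yd. noisy_data \<Sigma> N m1 M1 y \<delta> yd \<longrightarrow>
        (\<forall>j<N. KL_dist \<Sigma> (yd j) (kernel_op \<Omega> (a j) (x \<delta> yd (kstar \<delta> yd)))
                 \<le> ennreal (\<tau> * \<gamma> * \<delta> j))) \<and>
    \<comment> \<open>(iv)\<close>
     (\<forall>p\<ge>1. \<forall>j<N. \<forall>\<epsilon>>0. \<exists>\<eta>>0. \<forall>\<delta> yd.
        noisy_data \<Sigma> N m1 M1 y \<delta> yd \<and> (\<forall>i<N. \<delta> i < \<eta>) \<longrightarrow>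
        (\<lambda>s. kernel_op \<Omega> (a j) (x \<delta> yd (kstar \<delta> yd)) s - y j s) \<in> Lp_space \<Sigma> p \<and>
        Lp_norm \<Sigma> p (\<lambda>s. kernel_op \<Omega> (a j) (x \<delta> yd (kstar \<delta> yd)) s - y j s) < \<epsilon>) \<and>
    \<comment> \<open>(v)\<close>
     (\<forall>(\<delta>s :: nat \<Rightarrow> nat \<Rightarrow> real) (ys :: nat \<Rightarrow> nat \<Rightarrow> 'a \<Rightarrow> real) p.
        (\<forall>l. noisy_data \<Sigma> N m1 M1 y (\<delta>s l) (ys l)) \<and>
        (\<forall>j<N. (\<lambda>l. \<delta>s l j) \<longlonglongrightarrow> 0) \<and>
        1 < p \<and>
        (\<exists>B. \<forall>l. x (\<delta>s l) (ys l) (kstar (\<delta>s l) (ys l)) \<in> Lp_space \<Omega> p \<and>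
                 Lp_norm \<Omega> p (x (\<delta>s l) (ys l) (kstar (\<delta>s l) (ys l))) \<le> B)
        \<longrightarrow>
        (\<exists>(r :: nat \<Rightarrow> nat) z. strict_mono r \<and>
           weakly_converges_Lp \<Omega> p
             (\<lambda>l. x (\<delta>s (r l)) (ys (r l)) (kstar (\<delta>s (r l)) (ys (r l)))) z \<and>
           solves_system \<Omega> \<Sigma> N a y z))"
proof -
  have N0: "0 < N" using N by simp
  obtain xs where xs: "solves_system \<Omega> \<Sigma> N a y xs" "AE t in lebesgue_on \<Omega>. 0 \<le> xs t"
    "KL_dist \<Omega> xs x0 < \<infinity>"
    using A4 by blast
  have sets: "\<Omega> \<in> sets lebesgue" "\<Sigma> \<in> sets lebesgue"
    using domains open_in_sets_lebesgue by auto
  have fin: "finite_measure (lebesgue_on \<Omega>)" "finite_measure (lebesgue_on \<Sigma>)"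
    using domains by (auto intro!: finite_measure_lebesgue_on lmeasurable_open)
  have \<Omega>: "\<Omega> \<noteq> {}"
  proof
    assume "\<Omega> = {}"
    then have "(LINT t|lebesgue_on \<Omega>. x0 t) = (LINT t|lebesgue_on \<Omega>. 0)"
      by (intro Bochner_Integration.integral_cong) auto
    with start show False by (simp add: prob_densities_def)
  qed
  have \<Sigma>: "\<Sigma> \<noteq> {}"
  proof
    assume "\<Sigma> = {}"
    then have "(LINT s|lebesgue_on \<Sigma>. y 0 s) = (LINT s|lebesgue_on \<Sigma>. 0)"
      by (intro Bochner_Integration.integral_cong) auto
    with A3(1) N0 show False by simp
  qed
  \<comment> \<open>The kernel bounds hold almost everywhere on a nonempty open set, hence at some point.\<close>
  have mM: "m \<le> M"
  proof -
    have "AE (s, t) in lebesgue_on (\<Sigma> \<times> \<Omega>). m \<le> a 0 s t \<and> a 0 s t \<le> M" using A2(3) N0 by blast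
    moreover have "open (\<Sigma> \<times> \<Omega>)" "\<Sigma> \<times> \<Omega> \<noteq> {}" using domains \<Omega> \<Sigma> by (auto intro: open_Times)
    ultimately show ?thesis
      using AE_lebesgue_on_open_ex[of "\<Sigma> \<times> \<Omega>"] by fastforce
  qed
  have "\<exists>G. (\<lambda>(s, t). G s t) \<in> borel_measurable (lebesgue_on \<Sigma> \<Otimes>\<^sub>M lebesgue_on \<Omega>) \<and>
      (\<forall>s t. m \<le> G s t \<and> G s t \<le> M) \<and>
      (AE s in lebesgue_on \<Sigma>. AE t in lebesgue_on \<Omega>. a j s t = G s t) \<and>
      (AE t in lebesgue_on \<Omega>. AE s in lebesgue_on \<Sigma>. a j s t = G s t)" if j: "j < N" for j
  proof (rule borel_regularisation[OF domains(3,1) mM kernels[rule_format, OF j] A2(3)[rule_format, OF j]])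
  qed blast
  then have "\<exists>G. \<forall>j<N. (\<lambda>(s, t). G j s t) \<in> borel_measurable (lebesgue_on \<Sigma> \<Otimes>\<^sub>M lebesgue_on \<Omega>) \<and>
      (\<forall>s t. m \<le> G j s t \<and> G j s t \<le> M) \<and>
      (AE s in lebesgue_on \<Sigma>. AE t in lebesgue_on \<Omega>. a j s t = G j s t) \<and>
      (AE t in lebesgue_on \<Omega>. AE s in lebesgue_on \<Sigma>. a j s t = G j s t)"
    by (intro choice) blast
  then obtain G where Gm: "\<And>j. j < N \<Longrightarrow> (\<lambda>(s, t). G j s t) \<in> borel_measurable (lebesgue_on \<Sigma> \<Otimes>\<^sub>M lebesgue_on \<Omega>)"
    and Gb: "\<And>j s t. j < N \<Longrightarrow> m \<le> G j s t \<and> G j s t \<le> M"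
    and Ga: "\<And>j. j < N \<Longrightarrow> AE s in lebesgue_on \<Sigma>. AE t in lebesgue_on \<Omega>. a j s t = G j s t"
      "\<And>j. j < N \<Longrightarrow> AE t in lebesgue_on \<Omega>. AE s in lebesgue_on \<Sigma>. a j s t = G j s t"
    by blast
  have kp: "kernel_pair (lebesgue_on \<Omega>) (lebesgue_on \<Sigma>) (G j) m M" if j: "j < N" for j
  proof -
    interpret P: finite_measure "lebesgue_on \<Omega>" by (rule fin)
    interpret Q: finite_measure "lebesgue_on \<Sigma>" by (rule fin)
    show ?thesis
    proof unfold_locales
      have "AE t in lebesgue_on \<Omega>. (LINT s|lebesgue_on \<Sigma>. a j s t) = 1" using A1 j by blast
      then show "AE t in lebesgue_on \<Omega>. (LINT s|lebesgue_on \<Sigma>. G j s t) = 1"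
        using Ga(2)[OF j] AE_space
      proof eventually_elim
        case (elim t)
        have "(\<lambda>s. G j s t) \<in> borel_measurable (lebesgue_on \<Sigma>)"
          using measurable_Pair1[OF Gm[OF j] elim(3)] by simp
        then show ?case using LINT_lebesgue_on_cong_AE[OF sets(2) _ elim(2)] elim(1) by simp
      qed
    qed (use Gm Gb j A2 in auto)
  qed
  interpret O: osem_problem \<Omega> \<Sigma> N a G y x0 xs m M m1 M1 \<tau> \<gamma>
    by (intro osem_problem.intro domains N0 kp Ga data[rule_format] A3(1)[rule_format] start xs
        m1_M1(1) \<tau> \<gamma>)
  have x': "x = loping_osem \<Omega> \<Sigma> N a \<tau> \<gamma> x0" using x by (intro ext) simp
  have k': "kstar = (\<lambda>\<delta> yd. stop_index \<Omega> N (loping_osem \<Omega> \<Sigma> N a \<tau> \<gamma> x0 \<delta> yd))"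
    using kstar x by (intro ext) simp
  show ?thesis
    unfolding x' k'
  proof (intro conjI allI impI)
    show "\<exists>C::real. \<forall>\<delta> yd. noisy_data \<Sigma> N m1 M1 y \<delta> yd \<longrightarrow>
        real (stop_index \<Omega> N (loping_osem \<Omega> \<Sigma> N a \<tau> \<gamma> x0 \<delta> yd)) \<le> C / Min (\<delta> ` {..<N})"
      using O.kstar_bound by blast
  next
    fix \<delta>s :: "nat \<Rightarrow> nat \<Rightarrow> real" and ys :: "nat \<Rightarrow> nat \<Rightarrow> 'a \<Rightarrow> real" and p :: real
    let ?X = "\<lambda>l. loping_osem \<Omega> \<Sigma> N a \<tau> \<gamma> x0 (\<delta>s l) (ys l)
       (stop_index \<Omega> N (loping_osem \<Omega> \<Sigma> N a \<tau> \<gamma> x0 (\<delta>s l) (ys l)))"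
    assume *: "(\<forall>l. noisy_data \<Sigma> N m1 M1 y (\<delta>s l) (ys l)) \<and> (\<forall>j<N. (\<lambda>l. \<delta>s l j) \<longlonglongrightarrow> 0) \<and> 1 < p \<and>
        (\<exists>B. \<forall>l. ?X l \<in> Lp_space \<Omega> p \<and> Lp_norm \<Omega> p (?X l) \<le> B)"
    then obtain B where "\<And>l. ?X l \<in> Lp_space \<Omega> p" "\<And>l. Lp_norm \<Omega> p (?X l) \<le> B" by blast
    with * show "\<exists>(r :: nat \<Rightarrow> nat) z. strict_mono r \<and> weakly_converges_Lp \<Omega> p (\<lambda>l. ?X (r l)) z \<and>
        solves_system \<Omega> \<Sigma> N a y z"
      by (intro O.stopped_weak_convergence) auto
  qed (auto intro: O.stopped_residual_Lp O.kstar_residual dest: O.stop_indices_nonempty)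
qed

end
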